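(* Let $H$ be a polarized rational Hodge structure of weight $2$, with polarization form $\langle\,,\rangle$, which is also an associative unital $\mathbb{Q}$-algebra such that the product $H\otimes H\to H$ is a morphism of Hodge structures of bidegree $(-1,-1)$, and such that there exists an adjunction map $t:H\to H$ with $\langle ax,y\rangle=\langle x,t(a)y\rangle$ and $\langle xa,y\rangle=\langle x,yt(a)\rangle$ for all $a,x,y\in H$. Let $K$ be the center of $H$ and $K^+$ its $t$-invariant part. Then: - $K$ is a product of number fields. - $K^+$ is a product of totally real number fields $K_i^+$. - Let $e_i\in K^+$ be the idempotent corresponding to $K_i^+$ and $K_i:=e_iK$. If $K_i^+\neq K_i$, then $K_i$ is a field which becomes isomorphic to $\mathbb{C}$ under any embedding of $K_i^+$ into $\mathbb{R}$, i.e. $K_i\otimes_{\sigma(K_i^+)}\mathbb{R}\cong\mathbb{C}$ for every embedding $\sigma:K_i^+\hookrightarrow\mathbb{R}$.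
   Context: A polarized rational Hodge structure of weight $2$ is a finite-dimensional $\mathbb{Q}$-vector space $H$ with a decomposition $H_{\mathbb{C}}:=H\otimes\mathbb{C}=H^{2,0}\oplus H^{1,1}\oplus H^{0,2}$, $\overline{H^{2,0}}=H^{0,2}$, $\overline{H^{1,1}}=H^{1,1}$, and a rational symmetric bilinear form $\langle\,,\rangle$ such that the decomposition is orthogonal for $h(\alpha,\beta)=\langle\alpha,\overline{\beta}\rangle$, with $h$ positive definite on $H^{2,0}$ and $H^{0,2}$ and negative definite on $H^{1,1}$. The product, $\langle\,,\rangle$ and $t$ are extended $\mathbb{C}$-(bi)linearly to $H_{\mathbb{C}}$. Bidegree $(-1,-1)$ means $H^{p,q}\cdot H^{r,s}\subset H^{p+r-1,q+s-1}$, with $H^{p,q}=0$ unless $(p,q)\in\{(2,0),(1,1),(0,2)\}$. *)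

theory Defs
  imports
    Complex_Main
    "HOL-Library.Poly_Mapping"
    "HOL-Algebra.Chinese_Remainder"
    "HOL-Algebra.Embedded_Algebras"
    "HOL-Algebra.Algebraic_Closure_Type"
begin

section \<open>Rational vector spaces and unital rational algebras\<close>

class rat_vector = ab_group_add +
  fixes scaleQ :: "rat \<Rightarrow> 'a \<Rightarrow> 'a" (infixr \<open>*\<^sub>Q\<close> 75)
  assumes scaleQ_add_right: "q *\<^sub>Q (x + y) = q *\<^sub>Q x + q *\<^sub>Q y"
    and scaleQ_add_left: "(q + r) *\<^sub>Q x = q *\<^sub>Q x + r *\<^sub>Q x"
    and scaleQ_scaleQ: "q *\<^sub>Q r *\<^sub>Q x = (q * r) *\<^sub>Q x"
    and scaleQ_one: "1 *\<^sub>Q x = x"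

global_interpretation rat_vector: vector_space "scaleQ :: rat \<Rightarrow> 'a \<Rightarrow> 'a::rat_vector"
  by standard (fact scaleQ_add_right scaleQ_add_left scaleQ_scaleQ scaleQ_one)+

text \<open>The zero algebra is not excluded, which is why \<^class>\<open>ring_1\<close> is not used.\<close>

class rat_algebra = rat_vector + ring + monoid_mult +
  assumes mult_scaleQ_left: "(q *\<^sub>Q x) * y = q *\<^sub>Q (x * y)"
    and mult_scaleQ_right: "x * (q *\<^sub>Q y) = q *\<^sub>Q (x * y)"

instantiation complex :: rat_algebra
begin
definition scaleQ_complex :: "rat \<Rightarrow> complex \<Rightarrow> complex" where
  "scaleQ_complex q z = of_rat q * z"
instance
  by standard (simp_all add: scaleQ_complex_def algebra_simps of_rat_add of_rat_mult)
end


section \<open>Tensor products\<close>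

text \<open>
  The subgroup of the free abelian group on \<open>A \<times> B\<close> by which one divides to obtain the tensor
  product of \<open>A\<close> and \<open>B\<close> over \<open>F\<close>; the scalars \<open>F\<close> act on \<open>A\<close> by \<open>sa\<close> and on \<open>B\<close> by \<open>sb\<close>.
\<close>

inductive_set tensor_null ::
  "'f set \<Rightarrow> ('f \<Rightarrow> 'a \<Rightarrow> 'a) \<Rightarrow> ('f \<Rightarrow> 'b \<Rightarrow> 'b) \<Rightarrow> 'a::ab_group_add set \<Rightarrow> 'b::ab_group_add set
    \<Rightarrow> ('a \<times> 'b \<Rightarrow>\<^sub>0 int) set"
  for F sa sb A B where
  zero: "0 \<in> tensor_null F sa sb A B"
| diff: "x - y \<in> tensor_null F sa sb A B"
    if "x \<in> tensor_null F sa sb A B" "y \<in> tensor_null F sa sb A B"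
| add_left: "frag_of (a + a', b) - frag_of (a, b) - frag_of (a', b) \<in> tensor_null F sa sb A B"
    if "a \<in> A" "a' \<in> A" "b \<in> B"
| add_right: "frag_of (a, b + b') - frag_of (a, b) - frag_of (a, b') \<in> tensor_null F sa sb A B"
    if "a \<in> A" "b \<in> B" "b' \<in> B"
| balanced: "frag_of (sa f a, b) - frag_of (a, sb f b) \<in> tensor_null F sa sb A B"
    if "f \<in> F" "a \<in> A" "b \<in> B"

lemma tensor_null_uminus:
  assumes "x \<in> tensor_null F sa sb A B" shows "- x \<in> tensor_null F sa sb A B"
  using tensor_null.diff[OF tensor_null.zero assms] by simp

lemma tensor_null_add:
  assumes "x \<in> tensor_null F sa sb A B" "y \<in> tensor_null F sa sb A B"
  shows "x + y \<in> tensor_null F sa sb A B"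
  using tensor_null.diff[OF assms(1) tensor_null_uminus[OF assms(2)]] by simp


subsection \<open>Tensor products of rational vector spaces\<close>

abbreviation tensor_nullQ :: "('a::rat_vector \<times> 'b::rat_vector \<Rightarrow>\<^sub>0 int) set" where
  "tensor_nullQ \<equiv> tensor_null UNIV scaleQ scaleQ UNIV UNIV"

quotient_type (overloaded) ('a, 'b) tensor = "('a::rat_vector \<times> 'b::rat_vector) \<Rightarrow>\<^sub>0 int" /
  "\<lambda>x y. x - y \<in> tensor_nullQ"
proof (rule equivpI)
  show "reflp (\<lambda>x y. x - y \<in> (tensor_nullQ :: ('a \<times> 'b \<Rightarrow>\<^sub>0 int) set))"
    by (auto intro!: reflpI tensor_null.zero)
  show "symp (\<lambda>x y. x - y \<in> (tensor_nullQ :: ('a \<times> 'b \<Rightarrow>\<^sub>0 int) set))"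
    by (rule sympI) (drule tensor_null_uminus, simp)
  show "transp (\<lambda>x y. x - y \<in> (tensor_nullQ :: ('a \<times> 'b \<Rightarrow>\<^sub>0 int) set))"
    by (rule transpI) (drule (1) tensor_null_add, simp)
qed

lift_definition pure_tensor :: "'a::rat_vector \<Rightarrow> 'b::rat_vector \<Rightarrow> ('a, 'b) tensor" is
  "\<lambda>a b. frag_of (a, b)" .

lemma scaleQ_frag_tensor_null:
  assumes "x \<in> (tensor_nullQ :: ('a::rat_vector \<times> 'b::rat_vector \<Rightarrow>\<^sub>0 int) set)"
  shows "frag_extend (\<lambda>(a, b). frag_of (q *\<^sub>Q a, b)) x \<in> tensor_nullQ"
  using assms
proof induction
  case (balanced f a b)
  show ?case
    using tensor_null.balanced[of f UNIV "q *\<^sub>Q a" UNIV b UNIV scaleQ scaleQ]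
    by (simp add: frag_extend_diff scaleQ_scaleQ mult.commute)
qed (auto simp: frag_extend_diff scaleQ_add_right intro: tensor_null.intros)

lemma frag_tensor_induct:
  assumes "P 0" and "\<And>a b. P (frag_of (a, b))" and "\<And>x y. P x \<Longrightarrow> P y \<Longrightarrow> P (x - y)"
  shows "P x"
  by (rule frag_induction[of _ UNIV]) (use assms in auto)

instantiation tensor :: (rat_vector, rat_vector) rat_vector
begin

lift_definition zero_tensor :: "('a, 'b) tensor" is 0 .

lift_definition plus_tensor :: "('a, 'b) tensor \<Rightarrow> ('a, 'b) tensor \<Rightarrow> ('a, 'b) tensor" is "(+)"
  by (drule (1) tensor_null_add) (simp add: algebra_simps)

lift_definition uminus_tensor :: "('a, 'b) tensor \<Rightarrow> ('a, 'b) tensor" is uminus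
  by (drule tensor_null_uminus) simp

lift_definition minus_tensor :: "('a, 'b) tensor \<Rightarrow> ('a, 'b) tensor \<Rightarrow> ('a, 'b) tensor" is "(-)"
  by (drule (1) tensor_null.diff) (simp add: algebra_simps)

lift_definition scaleQ_tensor :: "rat \<Rightarrow> ('a, 'b) tensor \<Rightarrow> ('a, 'b) tensor" is
  "\<lambda>q. frag_extend (\<lambda>(a, b). frag_of (q *\<^sub>Q a, b))"
  by (drule scaleQ_frag_tensor_null) (simp add: frag_extend_diff)

instance
proof
  fix q r :: rat and x y z :: "('a, 'b) tensor"
  show "x + y + z = x + (y + z)"
    by transfer (simp add: add.assoc tensor_null.zero)
  show "x + y = y + x"
    by transfer (simp add: tensor_null.zero)
  show "0 + x = x"
    by transfer (simp add: tensor_null.zero)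
  show "- x + x = 0"
    by transfer (simp add: tensor_null.zero)
  show "x - y = x + - y"
    by transfer (simp add: tensor_null.zero)
  show "q *\<^sub>Q (x + y) = q *\<^sub>Q x + q *\<^sub>Q y"
    by transfer (simp add: frag_extend_add tensor_null.zero)
  show "(q + r) *\<^sub>Q x = q *\<^sub>Q x + r *\<^sub>Q x"
  proof transfer
    fix q r :: rat and x :: "'a \<times> 'b \<Rightarrow>\<^sub>0 int"
    let ?E = "\<lambda>q::rat. frag_extend (\<lambda>(a::'a, b::'b). frag_of (q *\<^sub>Q a, b))"
    show "?E (q + r) x - (?E q x + ?E r x) \<in> tensor_nullQ"
    proof (induction x rule: frag_tensor_induct)
      case (2 a b)
      show ?case
        using tensor_null.add_left[of "q *\<^sub>Q a" UNIV "r *\<^sub>Q a" b UNIV UNIV scaleQ scaleQ]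
        by (simp add: scaleQ_add_left algebra_simps)
    next
      case (3 x y)
      have "?E (q + r) (x - y) - (?E q (x - y) + ?E r (x - y)) =
          (?E (q + r) x - (?E q x + ?E r x)) - (?E (q + r) y - (?E q y + ?E r y))"
        unfolding frag_extend_diff by (simp only: diff_diff_eq2 diff_add_eq add_diff_eq diff_diff_eq ac_simps)
      with 3 show ?case
        by (simp only: tensor_null.diff)
    qed (simp add: tensor_null.zero)
  qed
  show "q *\<^sub>Q r *\<^sub>Q x = (q * r) *\<^sub>Q x"
  proof transfer
    fix q r :: rat and x :: "'a \<times> 'b \<Rightarrow>\<^sub>0 int"
    let ?E = "\<lambda>q::rat. frag_extend (\<lambda>(a::'a, b::'b). frag_of (q *\<^sub>Q a, b))"
    have "?E q (?E r x) = ?E (q * r) x"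
      by (induction x rule: frag_tensor_induct) (simp_all add: frag_extend_diff scaleQ_scaleQ)
    then show "?E q (?E r x) - ?E (q * r) x \<in> tensor_nullQ"
      by (simp add: tensor_null.zero)
  qed
  show "1 *\<^sub>Q x = x"
  proof transfer
    fix x :: "'a \<times> 'b \<Rightarrow>\<^sub>0 int"
    have "frag_extend (\<lambda>(a, b). frag_of (1 *\<^sub>Q a, b)) x = x"
      by (induction x rule: frag_tensor_induct) (simp_all add: frag_extend_diff scaleQ_one)
    then show "frag_extend (\<lambda>(a, b). frag_of (1 *\<^sub>Q a, b)) x - x \<in> tensor_nullQ"
      by (simp add: tensor_null.zero)
  qed
qed

end

lemma tensor_induct [case_names zero pure diff]:
  assumes "P 0" and "\<And>a b. P (pure_tensor a b)" and "\<And>x y. P x \<Longrightarrow> P y \<Longrightarrow> P (x - y)"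
  shows "P x"
proof -
  have "P (abs_tensor x)" for x
  proof (induction x rule: frag_tensor_induct)
    case 1 show ?case using assms(1) by (simp add: zero_tensor_def)
  next
    case (2 a b) show ?case using assms(2) by (simp add: pure_tensor.abs_eq)
  next
    case (3 x y) then show ?case using assms(3)[of "abs_tensor x" "abs_tensor y"] by (simp only: minus_tensor.abs_eq)
  qed
  from this[of "rep_tensor x"] show ?thesis
    by (simp only: Quotient_abs_rep[OF Quotient_tensor])
qed

definition balanced_map :: "('a::rat_vector \<Rightarrow> 'b::rat_vector \<Rightarrow> 'c::ab_group_add) \<Rightarrow> bool" where
  "balanced_map f \<longleftrightarrow>
     (\<forall>a a' b. f (a + a') b = f a b + f a' b) \<and>
     (\<forall>a b b'. f a (b + b') = f a b + f a b') \<and>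
     (\<forall>q a b. f (q *\<^sub>Q a) b = f a (q *\<^sub>Q b))"

text \<open>
  The additive map on the tensor product which a balanced map \<open>f\<close> induces; for such \<open>f\<close> it exists
  and is unique by the lemmas that follow.
\<close>

definition tensor_lift ::
  "('a::rat_vector \<Rightarrow> 'b::rat_vector \<Rightarrow> 'c::ab_group_add) \<Rightarrow> ('a, 'b) tensor \<Rightarrow> 'c" where
  "tensor_lift f =
     (THE g. (\<forall>x y. g (x + y) = g x + g y) \<and> (\<forall>a b. g (pure_tensor a b) = f a b))"

lemma additive_tensor_unique:
  fixes g h :: "('a::rat_vector, 'b::rat_vector) tensor \<Rightarrow> 'c::ab_group_add"
  assumes g: "\<And>x y. g (x + y) = g x + g y" and h: "\<And>x y. h (x + y) = h x + h y"
    and eq: "\<And>a b. g (pure_tensor a b) = h (pure_tensor a b)"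
  shows "g = h"
proof
  fix x
  have 0: "g 0 = 0" "h 0 = 0" using g[of 0 0] h[of 0 0] by simp_all
  have d: "g (x - y) = g x - g y" "h (x - y) = h x - h y" for x y
    using g[of "x - y" y] h[of "x - y" y] by (simp_all add: algebra_simps)
  show "g x = h x"
    by (induction x rule: tensor_induct) (simp_all add: 0 d eq)
qed

lemma tensor_lift_exists:
  fixes f :: "'a::rat_vector \<Rightarrow> 'b::rat_vector \<Rightarrow> 'c::rat_vector"
  assumes "balanced_map f"
  shows "\<exists>g. (\<forall>x y. g (x + y) = g x + g y) \<and> (\<forall>a b. g (pure_tensor a b) = f a b)"
proof -
  define E :: "('a \<times> 'b \<Rightarrow>\<^sub>0 int) \<Rightarrow> 'c" where
    "E x = (\<Sum>k\<in>Poly_Mapping.keys x. of_int (Poly_Mapping.lookup x k) *\<^sub>Q f (fst k) (snd k))" for x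
  have E_sup: "E x = (\<Sum>k\<in>S. of_int (Poly_Mapping.lookup x k) *\<^sub>Q f (fst k) (snd k))"
    if "finite S" "Poly_Mapping.keys x \<subseteq> S" for x S
    unfolding E_def using that
    by (intro sum.mono_neutral_left) (auto simp: in_keys_iff)
  have E_add: "E (x + y) = E x + E y" for x y
  proof -
    let ?S = "Poly_Mapping.keys x \<union> Poly_Mapping.keys y"
    have "finite ?S" "Poly_Mapping.keys (x + y) \<subseteq> ?S"
      by (simp_all add: Poly_Mapping.keys_add)
    then show ?thesis
      by (simp add: E_sup[of ?S] lookup_add scaleQ_add_left sum.distrib)
  qed
  have E_0: "E 0 = 0" by (simp add: E_def)
  have E_diff: "E (x - y) = E x - E y" for x y
    using E_add[of "x - y" y] by (simp add: algebra_simps)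
  have E_of: "E (frag_of (a, b)) = f a b" for a b
    by (simp add: E_def scaleQ_one)
  have null: "E x = 0" if "x \<in> tensor_nullQ" for x
    using that assms
    by induction (auto simp: E_0 E_diff E_of balanced_map_def)
  define g where "g x = E (rep_tensor x)" for x
  have g_abs: "g (abs_tensor x) = E x" for x
  proof -
    have "rep_tensor (abs_tensor x) - x \<in> tensor_nullQ"
      using Quotient_rep_abs[OF Quotient_tensor] by (simp add: tensor_null.zero)
    then show ?thesis using null E_diff by (fastforce simp: g_def)
  qed
  have "g (x + y) = g x + g y" for x y
  proof -
    have "g (abs_tensor (rep_tensor x) + abs_tensor (rep_tensor y)) = g x + g y"
      by (simp only: plus_tensor.abs_eq g_abs E_add) (simp add: g_def)
    then show ?thesis by (simp only: Quotient_abs_rep[OF Quotient_tensor])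
  qed
  moreover have "g (pure_tensor a b) = f a b" for a b
    by (simp add: pure_tensor.abs_eq g_abs E_of)
  ultimately show ?thesis by blast
qed

lemma
  fixes f :: "'a::rat_vector \<Rightarrow> 'b::rat_vector \<Rightarrow> 'c::rat_vector"
  assumes "balanced_map f"
  shows tensor_lift_add: "tensor_lift f (x + y) = tensor_lift f x + tensor_lift f y"
    and tensor_lift_pure: "tensor_lift f (pure_tensor a b) = f a b"
proof -
  have "\<exists>!g. (\<forall>x y. g (x + y) = g x + g y) \<and> (\<forall>a b. g (pure_tensor a b) = f a b)"
    by (rule ex_ex1I[OF tensor_lift_exists[OF assms]]) (rule additive_tensor_unique; simp)
  from theI'[OF this]
  show "tensor_lift f (x + y) = tensor_lift f x + tensor_lift f y"
    and "tensor_lift f (pure_tensor a b) = f a b"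
    by (simp_all flip: tensor_lift_def)
qed

lemma pure_tensor_add_left: "pure_tensor (a + a') b = pure_tensor a b + pure_tensor a' b"
proof transfer
  fix a a' :: 'a and b :: 'b
  have "frag_of (a + a', b) - frag_of (a, b) - frag_of (a', b) \<in> tensor_nullQ"
    by (rule tensor_null.add_left) simp_all
  then show "frag_of (a + a', b) - (frag_of (a, b) + frag_of (a', b)) \<in> tensor_nullQ"
    by (simp only: diff_diff_eq)
qed

lemma pure_tensor_add_right: "pure_tensor a (b + b') = pure_tensor a b + pure_tensor a b'"
proof transfer
  fix a :: 'a and b b' :: 'b
  have "frag_of (a, b + b') - frag_of (a, b) - frag_of (a, b') \<in> tensor_nullQ"
    by (rule tensor_null.add_right) simp_all
  then show "frag_of (a, b + b') - (frag_of (a, b) + frag_of (a, b')) \<in> tensor_nullQ"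
    by (simp only: diff_diff_eq)
qed

lemma pure_tensor_balanced: "pure_tensor (q *\<^sub>Q a) b = pure_tensor a (q *\<^sub>Q b)"
  by transfer (simp add: tensor_null.balanced)

lemma balanced_map_tensor_lift:
  fixes f :: "'a::rat_vector \<Rightarrow> 'b::rat_vector \<Rightarrow> 'c::rat_vector \<Rightarrow> 'd::rat_vector \<Rightarrow> 'e::rat_vector"
  assumes "\<And>a b. balanced_map (f a b)" and "\<And>c d. balanced_map (\<lambda>a b. f a b c d)"
  shows "balanced_map (\<lambda>a b. tensor_lift (f a b) y)"
  unfolding balanced_map_def
proof (intro conjI allI)
  note simps = tensor_lift_add[OF assms(1)] tensor_lift_pure[OF assms(1)]
  have bal: "f (a + a') b c d = f a b c d + f a' b c d" "f a (b + b') c d = f a b c d + f a b' c d"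
    "f (q *\<^sub>Q a) b c d = f a (q *\<^sub>Q b) c d" for a a' b b' c d q
    using assms(2)[of c d] by (simp_all add: balanced_map_def)
  fix a a' b b' and q :: rat
  have "tensor_lift (f (a + a') b) = (\<lambda>y. tensor_lift (f a b) y + tensor_lift (f a' b) y)"
    by (rule additive_tensor_unique) (simp_all add: simps bal algebra_simps)
  then show "tensor_lift (f (a + a') b) y = tensor_lift (f a b) y + tensor_lift (f a' b) y"
    by (rule fun_cong)
  have "tensor_lift (f a (b + b')) = (\<lambda>y. tensor_lift (f a b) y + tensor_lift (f a b') y)"
    by (rule additive_tensor_unique) (simp_all add: simps bal algebra_simps)
  then show "tensor_lift (f a (b + b')) y = tensor_lift (f a b) y + tensor_lift (f a b') y"
    by (rule fun_cong)
  have "tensor_lift (f (q *\<^sub>Q a) b) = tensor_lift (f a (q *\<^sub>Q b))"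
    by (rule additive_tensor_unique) (simp_all add: simps bal)
  then show "tensor_lift (f (q *\<^sub>Q a) b) y = tensor_lift (f a (q *\<^sub>Q b)) y"
    by (rule fun_cong)
qed

instantiation tensor :: (rat_algebra, rat_algebra) times
begin
definition times_tensor :: "('a, 'b) tensor \<Rightarrow> ('a, 'b) tensor \<Rightarrow> ('a, 'b) tensor" where
  "x * y = tensor_lift (\<lambda>a b. tensor_lift (\<lambda>a' b'. pure_tensor (a * a') (b * b')) y) x"
instance ..
end

lemma times_pure_tensor: "pure_tensor a b * pure_tensor a' b' = pure_tensor (a * a') (b * b')"
proof -
  have 1: "balanced_map (\<lambda>a' b'. pure_tensor (a * a') (b * b'))" for a :: 'a and b :: 'b
    by (simp add: balanced_map_def distrib_left pure_tensor_add_left pure_tensor_add_right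
        mult_scaleQ_right pure_tensor_balanced)
  have 2: "balanced_map (\<lambda>a b. pure_tensor (a * a') (b * b'))" for a' :: 'a and b' :: 'b
    by (simp add: balanced_map_def distrib_right pure_tensor_add_left pure_tensor_add_right
        mult_scaleQ_left pure_tensor_balanced)
  have 3: "balanced_map (\<lambda>a b. tensor_lift (\<lambda>a' b'. pure_tensor (a * a') (b * b')) y)"
    for y :: "('a, 'b) tensor"
    by (rule balanced_map_tensor_lift) (rule 1, rule 2)
  show ?thesis
    unfolding times_tensor_def tensor_lift_pure[OF 3] tensor_lift_pure[OF 1] tensor_lift_pure[OF 2] ..
qed


subsection \<open>Tensor products of subalgebras over a common ring of scalars\<close>

text \<open>
  \<open>A\<close> and \<open>B\<close> are closed under addition and multiplication and have units \<open>eA\<close> and \<open>eB\<close>, which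
  may differ from the unit of the ambient type. The tensor product is the quotient of the monoid
  ring of \<open>A \<times> B\<close> over the integers by the tensor relations (which form an ideal as soon as the
  scalar actions are compatible with the products).
\<close>

definition pair_ring ::
  "'a::ring set \<Rightarrow> 'a \<Rightarrow> 'b::ring set \<Rightarrow> 'b \<Rightarrow> ('a \<times> 'b \<Rightarrow>\<^sub>0 int) ring" where
  "pair_ring A eA B eB =
     \<lparr>carrier = {x. Poly_Mapping.keys x \<subseteq> A \<times> B},
      monoid.mult = (\<lambda>x y. frag_extend (\<lambda>(a, b). frag_extend (\<lambda>(a', b'). frag_of (a * a', b * b')) y) x),
      one = frag_of (eA, eB), ring.zero = 0, add = (+)\<rparr>"

definition tensor_algebra ::
  "'f set \<Rightarrow> ('f \<Rightarrow> 'a \<Rightarrow> 'a) \<Rightarrow> ('f \<Rightarrow> 'b \<Rightarrow> 'b) \<Rightarrow> 'a::ring set \<Rightarrow> 'a \<Rightarrow> 'b::ring set \<Rightarrow> 'b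
    \<Rightarrow> ('a \<times> 'b \<Rightarrow>\<^sub>0 int) set ring" where
  "tensor_algebra F sa sb A eA B eB = pair_ring A eA B eB Quot tensor_null F sa sb A B"

text \<open>
  \<open>real_base_change k \<sigma> A e\<close> is the base change to the real numbers, along \<open>\<sigma>\<close>, of the algebra
  \<open>A\<close> with unit \<open>e\<close> over its subring \<open>k\<close>.
\<close>

definition real_base_change ::
  "'a::ring set \<Rightarrow> ('a \<Rightarrow> real) \<Rightarrow> 'a set \<Rightarrow> 'a \<Rightarrow> ('a \<times> real \<Rightarrow>\<^sub>0 int) set ring" where
  "real_base_change k \<sigma> A e = tensor_algebra k (*) (\<lambda>c r. \<sigma> c * r) A e UNIV 1"

definition real_base_change_scalar ::
  "'a::ring set \<Rightarrow> ('a \<Rightarrow> real) \<Rightarrow> 'a set \<Rightarrow> 'a \<Rightarrow> real \<Rightarrow> ('a \<times> real \<Rightarrow>\<^sub>0 int) set" where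
  "real_base_change_scalar k \<sigma> A e r =
     tensor_null k (*) (\<lambda>c r. \<sigma> c * r) A UNIV +>\<^bsub>pair_ring A e UNIV 1\<^esub> frag_of (e, r)"

text \<open>Isomorphism with the complex numbers as real algebras.\<close>

definition base_change_is_complex ::
  "'a::ring set \<Rightarrow> ('a \<Rightarrow> real) \<Rightarrow> 'a set \<Rightarrow> 'a \<Rightarrow> bool" where
  "base_change_is_complex k \<sigma> A e \<longleftrightarrow>
     (\<exists>\<phi> \<in> ring_iso (real_base_change k \<sigma> A e) (ring_of_type_algebra :: complex ring).
        \<forall>r. \<phi> (real_base_change_scalar k \<sigma> A e r) = of_real r)"


section \<open>Complexification and polarized Hodge structures of weight 2\<close>

type_synonym 'h complexification = "('h, complex) tensor"

definition cscale :: "complex \<Rightarrow> 'h::rat_vector complexification \<Rightarrow> 'h complexification" where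
  "cscale z = tensor_lift (\<lambda>a w. pure_tensor a (z * w))"

definition cconj :: "'h::rat_vector complexification \<Rightarrow> 'h complexification" where
  "cconj = tensor_lift (\<lambda>a w. pure_tensor a (cnj w))"

definition complexify_form ::
  "('h::rat_vector \<Rightarrow> 'h \<Rightarrow> rat) \<Rightarrow> 'h complexification \<Rightarrow> 'h complexification \<Rightarrow> complex" where
  "complexify_form \<beta> x y = tensor_lift (\<lambda>a z. tensor_lift (\<lambda>b w. of_rat (\<beta> a b) * z * w) y) x"

lemma cscale_pure: "cscale z (pure_tensor a w) = pure_tensor a (z * w)"
  unfolding cscale_def
  by (rule tensor_lift_pure)
    (simp add: balanced_map_def distrib_left pure_tensor_add_left pure_tensor_add_right
      mult_scaleQ_right pure_tensor_balanced)

lemma cconj_pure: "cconj (pure_tensor a w) = pure_tensor a (cnj w)"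
proof -
  have "cnj (of_rat q) = of_rat q" for q
    by (cases q) (simp add: of_rat_rat)
  then have "balanced_map (\<lambda>a w. pure_tensor a (cnj w))"
    by (simp add: balanced_map_def pure_tensor_add_left pure_tensor_add_right pure_tensor_balanced
        scaleQ_complex_def)
  then show ?thesis
    unfolding cconj_def by (rule tensor_lift_pure)
qed

lemma complexify_form_pure:
  assumes add: "\<And>a a' b. \<beta> (a + a') b = \<beta> a b + \<beta> a' b" "\<And>a b b'. \<beta> a (b + b') = \<beta> a b + \<beta> a b'"
    and scale: "\<And>q a b. \<beta> (q *\<^sub>Q a) b = q * \<beta> a b" "\<And>q a b. \<beta> a (q *\<^sub>Q b) = q * \<beta> a b"
  shows "complexify_form \<beta> (pure_tensor a z) (pure_tensor b w) = of_rat (\<beta> a b) * z * w"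
proof -
  have 1: "balanced_map (\<lambda>b w. of_rat (\<beta> a b) * z * w :: complex)" for a z
    by (simp add: balanced_map_def add scale scaleQ_complex_def of_rat_add of_rat_mult
        distrib_left distrib_right mult.commute mult.left_commute)
  have 2: "balanced_map (\<lambda>a z. of_rat (\<beta> a b) * z * w :: complex)" for b w
    by (simp add: balanced_map_def add scale scaleQ_complex_def of_rat_add of_rat_mult
        distrib_left distrib_right mult.commute mult.left_commute)
  have 3: "balanced_map (\<lambda>a z. tensor_lift (\<lambda>b w. of_rat (\<beta> a b) * z * w :: complex) y)" for y
    by (rule balanced_map_tensor_lift) (rule 1, rule 2)
  show ?thesis
    unfolding complexify_form_def tensor_lift_pure[OF 3] tensor_lift_pure[OF 1] tensor_lift_pure[OF 2] ..
qed

definition complex_subspace :: "'h::rat_vector complexification set \<Rightarrow> bool" where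
  "complex_subspace S \<longleftrightarrow>
     0 \<in> S \<and> (\<forall>x\<in>S. \<forall>y\<in>S. x + y \<in> S) \<and> (\<forall>z. \<forall>x\<in>S. cscale z x \<in> S)"

definition hermitian_form ::
  "('h::rat_vector \<Rightarrow> 'h \<Rightarrow> rat) \<Rightarrow> 'h complexification \<Rightarrow> 'h complexification \<Rightarrow> complex" where
  "hermitian_form \<beta> x y = complexify_form \<beta> x (cconj y)"

definition positive_definite_on ::
  "'h::rat_vector complexification set
    \<Rightarrow> ('h complexification \<Rightarrow> 'h complexification \<Rightarrow> complex) \<Rightarrow> bool" where
  "positive_definite_on S h \<longleftrightarrow> (\<forall>x\<in>S. x \<noteq> 0 \<longrightarrow> h x x \<in> \<real> \<and> Re (h x x) > 0)"

definition negative_definite_on ::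
  "'h::rat_vector complexification set
    \<Rightarrow> ('h complexification \<Rightarrow> 'h complexification \<Rightarrow> complex) \<Rightarrow> bool" where
  "negative_definite_on S h \<longleftrightarrow> (\<forall>x\<in>S. x \<noteq> 0 \<longrightarrow> h x x \<in> \<real> \<and> Re (h x x) < 0)"

locale polarized_hodge_structure_2 =
  fixes Hdg :: "int \<Rightarrow> int \<Rightarrow> 'h::rat_vector complexification set"
    and form :: "'h \<Rightarrow> 'h \<Rightarrow> rat"
  assumes finite_dimensional: "\<exists>B::'h set. finite B \<and> rat_vector.span B = UNIV"
    and Hdg_subspace: "complex_subspace (Hdg p q)"
    and Hdg_trivial: "(p, q) \<notin> {(2, 0), (1, 1), (0, 2)} \<Longrightarrow> Hdg p q = {0}"
    and Hdg_decomposition: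
      "\<exists>!(u, v, w). u \<in> Hdg 2 0 \<and> v \<in> Hdg 1 1 \<and> w \<in> Hdg 0 2 \<and> x = u + v + w"
    and cconj_Hdg_20: "cconj ` Hdg 2 0 = Hdg 0 2"
    and cconj_Hdg_11: "cconj ` Hdg 1 1 = Hdg 1 1"
    and form_sym: "form a b = form b a"
    and form_add: "form (a + a') b = form a b + form a' b"
    and form_scale: "form (c *\<^sub>Q a) b = c * form a b"
    and Hdg_orthogonal:
      "(p, q) \<noteq> (r, s) \<Longrightarrow> x \<in> Hdg p q \<Longrightarrow> y \<in> Hdg r s \<Longrightarrow> hermitian_form form x y = 0"
    and positive_20: "positive_definite_on (Hdg 2 0) (hermitian_form form)"
    and positive_02: "positive_definite_on (Hdg 0 2) (hermitian_form form)"
    and negative_11: "negative_definite_on (Hdg 1 1) (hermitian_form form)"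

text \<open>
  No linearity is required of the adjunction map \<open>t\<close>: it follows from the adjunction
  identities, because \<open>form\<close> is nondegenerate.
\<close>

locale hodge_algebra_2 = polarized_hodge_structure_2 Hdg form
  for Hdg :: "int \<Rightarrow> int \<Rightarrow> 'h::rat_algebra complexification set"
    and form :: "'h \<Rightarrow> 'h \<Rightarrow> rat" +
  fixes t :: "'h \<Rightarrow> 'h"
  assumes mult_bidegree:
      "x \<in> Hdg p q \<Longrightarrow> y \<in> Hdg r s \<Longrightarrow> x * y \<in> Hdg (p + r - 1) (q + s - 1)"
    and adjoint_left: "form (a * u) v = form u (t a * v)"
    and adjoint_right: "form (u * a) v = form u (v * t a)"


section \<open>Products of number fields\<close>

definition number_field :: "'a ring \<Rightarrow> bool" where
  "number_field L \<longleftrightarrow> field L \<and>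
     (\<exists>\<iota> \<in> ring_hom (ring_of_type_algebra :: rat ring) L.
        ring.finite_dimension L (range \<iota>) (carrier L))"

definition totally_real :: "'a ring \<Rightarrow> bool" where
  "totally_real L \<longleftrightarrow>
     (\<forall>\<tau> \<in> ring_hom L (ring_of_type_algebra :: complex ring). \<tau> ` carrier L \<subseteq> \<real>)"

definition factor_ring :: "'a ring \<Rightarrow> 'a \<Rightarrow> 'a ring" where
  "factor_ring R e = R\<lparr>carrier := (\<lambda>x. e \<otimes>\<^bsub>R\<^esub> x) ` carrier R, one := e\<rparr>"

text \<open>
  The ring \<open>R\<close> is the product of its factors \<open>e R\<close>, with \<open>e\<close> ranging over the list \<open>es\<close>. That
  the map is an isomorphism forces \<open>es\<close> to consist of orthogonal idempotents with sum one.
\<close>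

definition ring_product_by :: "'a ring \<Rightarrow> 'a list \<Rightarrow> bool" where
  "ring_product_by R es \<longleftrightarrow> set es \<subseteq> carrier R \<and>
     (\<lambda>x. map (\<lambda>e. e \<otimes>\<^bsub>R\<^esub> x) es) \<in> ring_iso R (RDirProd_list (map (factor_ring R) es))"

definition center_ring :: "'h::rat_algebra ring" where
  "center_ring =
     \<lparr>carrier = {a. \<forall>x. a * x = x * a}, monoid.mult = (*), one = 1, ring.zero = 0, add = (+)\<rparr>"

definition center_invariants :: "('h \<Rightarrow> 'h) \<Rightarrow> 'h::rat_algebra ring" where
  "center_invariants t = center_ring\<lparr>carrier := {a \<in> carrier center_ring. t a = a}\<rparr>"

end

(* The (2,0)-component u of a central element of H_C is central and squares to zero for degree
   reasons; comparing it with its h-adjoint, h being definite on every graded piece, gives u = 0.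
   So the center K lies in H^{1,1} and -<,> is a positive definite rational form on K for which t is
   an adjunction, that is, a positive involution. Hence K and K^+ are reduced, thus products of
   fields. Multiplication by c in K^+ is selfadjoint, and every embedding of a factor of K^+ is given
   by a common eigenvector, so its values are real. A nonzero x in K_i has x t(x) nonzero in
   K_i^+, so K_i is a field. If K_i differs from K_i^+, it is K_i^+ + K_i^+ a with t(a) = -a, and
   -a^2 = a t(a) is positive under every real embedding, so adjoining a over the reals yields the
   complex numbers. *)
theory Submission
  imports Defs
begin

section \<open>The center lies in degree (1,1)\<close>

text \<open>Positivity is known on rational vectors only, while embeddings take real or complex
  values. A basis orthogonal over the rationals bridges this: it writes the form as a weighted sum
  of squares with positive rational weights, and such an expression can be evaluated in any field of
  characteristic zero. The basis is never normalised, because square roots would leave the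
  rationals, so weights \<open>1 / B g g\<close> accompany every sum. An embedding is in particular
  a linear functional, represented by the vector with coordinates \<open>\<tau> g / B g g\<close>;
  this one vector yields both the reality of \<open>\<tau>\<close> and the sign of
  \<open>\<sigma> (\<alpha> * \<alpha>)\<close>. The last claim concerns every decomposition of K^+
  into number fields, not just the one constructed. Hence the arguments on a factor assume only that
  \<open>e\<close> lies in K^+ and that e K^+ is a field. The base change to the reals is a quotient
  of a ring of formal sums. It is identified by an evaluation map to the complex numbers whose
  kernel is found from a normal form with two real coordinates.\<close>

lemma balanced_map_times_pure_right:
  "balanced_map (\<lambda>a' b'. pure_tensor (a * a') (b * b'))" for a :: "'a::rat_algebra" and b :: "'b::rat_algebra"
  by (simp add: balanced_map_def distrib_left pure_tensor_add_left pure_tensor_add_right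
      mult_scaleQ_right pure_tensor_balanced)

lemma balanced_map_times_pure_left:
  "balanced_map (\<lambda>a b. pure_tensor (a * a') (b * b'))" for a' :: "'a::rat_algebra" and b' :: "'b::rat_algebra"
  by (simp add: balanced_map_def distrib_right pure_tensor_add_left pure_tensor_add_right
      mult_scaleQ_left pure_tensor_balanced)

lemma balanced_map_times_tensor:
  "balanced_map (\<lambda>a b. tensor_lift (\<lambda>a' b'. pure_tensor (a * a') (b * b')) y)"
  for y :: "('a::rat_algebra, 'b::rat_algebra) tensor"
  by (rule balanced_map_tensor_lift)
    (rule balanced_map_times_pure_right, rule balanced_map_times_pure_left)

text \<open>Inductions over tensors and formal sums have cases for zero, generators and differences;
  this turns additivity into the two rules that such inductions consume.\<close>

lemma additive_zero_diff:
  fixes f :: "'a::ab_group_add \<Rightarrow> 'b::ab_group_add"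
  assumes "\<And>x y. f (x + y) = f x + f y"
  shows "f 0 = 0" and "f (x - y) = f x - f y"
proof -
  show "f 0 = 0" using assms[of 0 0] by simp
  show "f (x - y) = f x - f y" using assms[of "x - y" y] by simp
qed

lemma times_tensor_add_left: "(x + x') * y = x * y + x' * y"
  for x x' y :: "('a::rat_algebra, 'b::rat_algebra) tensor"
  unfolding times_tensor_def by (rule tensor_lift_add[OF balanced_map_times_tensor])

lemma times_tensor_pure_left:
  "pure_tensor a b * y = tensor_lift (\<lambda>a' b'. pure_tensor (a * a') (b * b')) y"
  unfolding times_tensor_def by (rule tensor_lift_pure[OF balanced_map_times_tensor])

lemma times_tensor_add_right: "x * (y + y') = x * y + x * y'"
  for x y y' :: "('a::rat_algebra, 'b::rat_algebra) tensor"
proof (induction x rule: tensor_induct)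
  case (pure a b)
  show ?case unfolding times_tensor_pure_left
    by (rule tensor_lift_add[OF balanced_map_times_pure_right])
qed (simp_all add: additive_zero_diff[of "\<lambda>x. x * _", OF times_tensor_add_left])

lemma times_tensor_diff_left: "(x - x') * y = x * y - x' * y"
  for x x' y :: "('a::rat_algebra, 'b::rat_algebra) tensor"
  by (rule additive_zero_diff(2)[of "\<lambda>x. x * y", OF times_tensor_add_left])

lemma times_tensor_diff_right: "x * (y - y') = x * y - x * y'"
  for x y y' :: "('a::rat_algebra, 'b::rat_algebra) tensor"
  by (rule additive_zero_diff(2)[of "\<lambda>y. x * y", OF times_tensor_add_right])

lemma times_tensor_zero: "0 * y = 0" "y * 0 = 0"
  for y :: "('a::rat_algebra, 'b::rat_algebra) tensor"
  using additive_zero_diff(1)[of "\<lambda>x. x * y", OF times_tensor_add_left]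
    additive_zero_diff(1)[of "\<lambda>x. y * x", OF times_tensor_add_right] by simp_all

instance tensor :: (rat_algebra, rat_algebra) ring
proof
  fix x y z :: "('a, 'b) tensor"
  note zd = times_tensor_zero times_tensor_diff_left times_tensor_diff_right
  have 1: "pure_tensor a b * pure_tensor a' b' * z = pure_tensor a b * (pure_tensor a' b' * z)"
    for a a' :: 'a and b b' :: 'b
    by (induction z rule: tensor_induct) (simp_all add: zd times_pure_tensor mult.assoc)
  have 2: "pure_tensor a b * y * z = pure_tensor a b * (y * z)" for a :: 'a and b :: 'b
    by (induction y rule: tensor_induct) (simp_all add: zd 1)
  show "x * y * z = x * (y * z)"
    by (induction x rule: tensor_induct) (simp_all add: zd 2)
qed (fact times_tensor_add_left times_tensor_add_right)+

lemma pure_tensor_one_times: "pure_tensor 1 1 * x = x" "x * pure_tensor 1 1 = x"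
  for x :: "('a::rat_algebra, 'b::rat_algebra) tensor"
  by (induction x rule: tensor_induct) (simp_all add: algebra_simps times_pure_tensor)

text \<open>H embeds into its complexification: extending \<open>x\<close> to a basis gives a
  rational coordinate functional \<open>f\<close> with \<open>f x = 1\<close>, and the map induced
  by \<open>of_rat (f a) * z\<close> sends the tensor of \<open>x\<close> and 1 to 1.\<close>

lemma pure_tensor_one_eq_0:
  fixes x :: "'a::rat_vector"
  assumes "pure_tensor x (1::complex) = 0"
  shows "x = 0"
proof (rule ccontr)
  assume "x \<noteq> 0"
  define B where "B = rat_vector.extend_basis {x}"
  have ind: "rat_vector.independent {x}" using \<open>x \<noteq> 0\<close> by simp
  have B: "rat_vector.independent B" "x \<in> B" and sB: "\<And>v. v \<in> rat_vector.span B"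
    using rat_vector.independent_extend_basis[OF ind] rat_vector.extend_basis_superset[OF ind]
      rat_vector.span_extend_basis[OF ind] by (auto simp: B_def)
  define f where "f v = rat_vector.representation B v x" for v
  have f: "f (v + w) = f v + f w" "f (q *\<^sub>Q v) = q * f v" for v w q
    by (simp_all add: f_def rat_vector.representation_add[OF B(1) sB sB]
        rat_vector.representation_scale[OF B(1) sB])
  have "f x = 1"
    by (simp add: f_def rat_vector.representation_basis[OF B])
  have bal: "balanced_map (\<lambda>a z. of_rat (f a) * z :: complex)"
    by (simp add: balanced_map_def f of_rat_add of_rat_mult scaleQ_complex_def algebra_simps)
  have "tensor_lift (\<lambda>a z. of_rat (f a) * z) (pure_tensor x 1) = (1::complex)"
    by (simp add: tensor_lift_pure[OF bal] \<open>f x = 1\<close>)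
  then show False
    using additive_zero_diff(1)[of "tensor_lift (\<lambda>a z. of_rat (f a) * z) :: _ \<Rightarrow> complex",
        OF tensor_lift_add[OF bal]] assms by simp
qed

section \<open>Conjugation and the Hermitian form on the complexification\<close>

lemma cnj_of_rat: "cnj (of_rat q) = of_rat q"
  by (cases q) (simp add: of_rat_rat)

lemma balanced_map_cnj: "balanced_map (\<lambda>a w. pure_tensor a (cnj w))"
  by (simp add: balanced_map_def pure_tensor_add_left pure_tensor_add_right pure_tensor_balanced
        scaleQ_complex_def cnj_of_rat)

lemma cconj_add: "cconj (x + y) = cconj x + cconj y"
  unfolding cconj_def by (rule tensor_lift_add[OF balanced_map_cnj])

lemmas cconj_zero = additive_zero_diff(1)[OF cconj_add]
  and cconj_diff = additive_zero_diff(2)[OF cconj_add]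

lemma cconj_cconj: "cconj (cconj x) = x"
  by (induction x rule: tensor_induct) (simp_all add: cconj_zero cconj_diff cconj_pure)

context polarized_hodge_structure_2
begin

lemma form_add_right: "form a (b + b') = form a b + form a b'"
  using form_add[of b b' a] by (simp add: form_sym)

lemma form_scale_right: "form a (q *\<^sub>Q b) = q * form a b"
  using form_scale[of q b a] by (simp add: form_sym)

abbreviation h where "h \<equiv> hermitian_form form"

lemma balanced_map_form_right: "balanced_map (\<lambda>b w. of_rat (form a b) * z * w :: complex)"
  by (simp add: balanced_map_def form_add_right form_scale_right scaleQ_complex_def of_rat_add
      of_rat_mult algebra_simps)

lemma balanced_map_form_left: "balanced_map (\<lambda>a z. of_rat (form a b) * z * w :: complex)"
  by (simp add: balanced_map_def form_add form_scale scaleQ_complex_def of_rat_add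
      of_rat_mult algebra_simps)

lemma balanced_map_form:
  "balanced_map (\<lambda>a z. tensor_lift (\<lambda>b w. of_rat (form a b) * z * w :: complex) y)"
  by (rule balanced_map_tensor_lift) (rule balanced_map_form_right, rule balanced_map_form_left)

lemma complexify_form_add_left:
  "complexify_form form (x + x') y = complexify_form form x y + complexify_form form x' y"
  unfolding complexify_form_def by (rule tensor_lift_add[OF balanced_map_form])

lemma h_pure: "h (pure_tensor a z) (pure_tensor b w) = of_rat (form a b) * z * cnj w"
  by (simp add: hermitian_form_def cconj_pure
      complexify_form_pure[OF form_add form_add_right form_scale form_scale_right])

lemma h_add_left: "h (x + x') y = h x y + h x' y"
  by (simp add: hermitian_form_def complexify_form_add_left)

lemmas h_zero_left = additive_zero_diff(1)[of "\<lambda>x. h x _", OF h_add_left]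
  and h_diff_left = additive_zero_diff(2)[of "\<lambda>x. h x _", OF h_add_left]

lemma complexify_form_pure_left:
  "complexify_form form (pure_tensor a z) y = tensor_lift (\<lambda>b w. of_rat (form a b) * z * w) y"
  unfolding complexify_form_def by (rule tensor_lift_pure[OF balanced_map_form])

lemma h_add_right: "h x (y + y') = h x y + h x y'"
proof (induction x rule: tensor_induct)
  case (pure a z)
  show ?case
    by (simp add: hermitian_form_def complexify_form_pure_left cconj_add
        tensor_lift_add[OF balanced_map_form_right])
qed (simp_all add: h_zero_left h_diff_left)

lemmas h_zero_right = additive_zero_diff(1)[of "h _", OF h_add_right]
  and h_diff_right = additive_zero_diff(2)[of "h _", OF h_add_right]

lemma h_commute: "h y x = cnj (h x y)"
proof -
  have 1: "h (pure_tensor b w) x = cnj (h x (pure_tensor b w))" for b w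
    by (induction x rule: tensor_induct)
      (simp_all add: h_zero_left h_zero_right h_diff_left h_diff_right h_pure cnj_of_rat
        form_sym[of b] algebra_simps)
  show ?thesis
    by (induction y rule: tensor_induct)
      (simp_all add: h_zero_left h_zero_right h_diff_left h_diff_right 1)
qed

lemma Hdg_cases:
  assumes "x \<in> Hdg p q"
  obtains "x = 0" | "p = 2" "q = 0" | "p = 1" "q = 1" | "p = 0" "q = 2"
  using assms Hdg_trivial[of p q] by (cases "(p, q) \<in> {(2, 0), (1, 1), (0, 2)}") auto

lemma h_definite:
  assumes "x \<in> Hdg p q" and "h x x = 0"
  shows "x = 0"
proof (rule ccontr)
  assume "x \<noteq> 0"
  from assms(1) show False
  proof (cases rule: Hdg_cases)
    case 2
    with assms \<open>x \<noteq> 0\<close> positive_20 show False by (auto simp: positive_definite_on_def)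
  next
    case 3
    with assms \<open>x \<noteq> 0\<close> negative_11 show False by (auto simp: negative_definite_on_def)
  next
    case 4
    with assms \<open>x \<noteq> 0\<close> positive_02 show False by (auto simp: positive_definite_on_def)
  qed (use \<open>x \<noteq> 0\<close> in simp)
qed

lemma Hdg_decompose:
  obtains u v w where "u \<in> Hdg 2 0" "v \<in> Hdg 1 1" "w \<in> Hdg 0 2" "x = u + v + w"
  using Hdg_decomposition[of x] by blast

lemma Hdg_unique:
  assumes "u \<in> Hdg 2 0" "v \<in> Hdg 1 1" "w \<in> Hdg 0 2"
    and "u' \<in> Hdg 2 0" "v' \<in> Hdg 1 1" "w' \<in> Hdg 0 2"
    and "u + v + w = u' + v' + w'"
  shows "u = u'" "v = v'" "w = w'"
proof -
  have "(u, v, w) = (u', v', w')"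
    using Hdg_decomposition[of "u + v + w"] by (rule ex1E) (use assms in auto)
  then show "u = u'" "v = v'" "w = w'" by simp_all
qed

lemma Hdg_zero: "0 \<in> Hdg p q"
  using Hdg_subspace by (simp add: complex_subspace_def)

text \<open>\<open>h\<close> is indefinite on the whole complexification, so isotropy alone does not
  give zero. Each component of \<open>z\<close> pairs with \<open>z\<close> as it does with itself;
  by \<open>orth\<close> only the component of type \<open>(p, q)\<close> can survive, and there
  \<open>h\<close> is definite.\<close>

lemma isotropic_orthogonal_eq_0:
  assumes orth: "\<And>r s y. (r, s) \<noteq> (p, q) \<Longrightarrow> y \<in> Hdg r s \<Longrightarrow> h y z = 0"
    and iso: "h z z = 0"
  shows "z = 0"
proof -
  obtain u v w where uvw: "u \<in> Hdg 2 0" "v \<in> Hdg 1 1" "w \<in> Hdg 0 2" "z = u + v + w"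
    by (rule Hdg_decompose)
  have hz: "h u z = h u u" "h v z = h v v" "h w z = h w w"
    using Hdg_orthogonal[OF _ uvw(1,2)] Hdg_orthogonal[OF _ uvw(1,3)] Hdg_orthogonal[OF _ uvw(2,1)]
      Hdg_orthogonal[OF _ uvw(2,3)] Hdg_orthogonal[OF _ uvw(3,1)] Hdg_orthogonal[OF _ uvw(3,2)]
    by (simp_all add: uvw(4) h_add_right)
  have u: "(2, 0) \<noteq> (p, q) \<Longrightarrow> u = 0" and v: "(1, 1) \<noteq> (p, q) \<Longrightarrow> v = 0"
    and w: "(0, 2) \<noteq> (p, q) \<Longrightarrow> w = 0"
    using orth hz uvw h_definite by metis+
  have "h z z = h u u + h v v + h w w"
    using hz by (simp add: uvw(4) h_add_left)
  with iso have "h u u + h v v + h w w = 0" by simp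
  then have "u = 0 \<and> v = 0 \<and> w = 0"
    using u v w uvw(1-3) h_definite
    by (cases "(p, q) = (2, 0)"; cases "(p, q) = (1, 1)"; cases "(p, q) = (0, 2)")
      (auto simp: h_zero_left)
  then show ?thesis by (simp add: uvw)
qed

lemma form_nondegenerate:
  assumes "\<And>y. form x y = 0"
  shows "x = 0"
proof -
  let ?X = "pure_tensor x (1::complex)"
  have 0: "h ?X Y = 0" for Y
    by (induction Y rule: tensor_induct) (simp_all add: h_zero_right h_diff_right h_pure assms)
  have "h y ?X = 0" for y using 0[of y] h_commute[of y ?X] by simp
  \<comment> \<open>None of the three pieces has type \<open>(0, 0)\<close>, so this choice makes
    the orthogonality hypothesis apply to all of them.\<close>
  then have "?X = 0" by (intro isotropic_orthogonal_eq_0[of 0 0]) auto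
  then show ?thesis by (rule pure_tensor_one_eq_0)
qed

lemma form_diff_left: "form (a - a') b = form a b - form a' b"
  by (rule additive_zero_diff(2)[of "\<lambda>a. form a b", OF form_add])

text \<open>The map \<open>t\<close> is known only through its adjunction identities, so its
  linearity, involutivity and behaviour on products are all obtained by pairing with an arbitrary
  vector.\<close>

lemma form_eqI:
  assumes "\<And>y. form x y = form x' y"
  shows "x = x'"
  using form_nondegenerate[of "x - x'"] assms by (simp add: form_diff_left)

end

section \<open>The adjunction map and the type of central elements\<close>

context hodge_algebra_2
begin

lemma adjoint_left': "form (t a * x) y = form x (a * y)"
  using adjoint_left[of a y x] by (simp add: form_sym)

lemma form_t_left: "form (t a) u = form 1 (a * u)"
  using adjoint_left'[of a 1 u] by simp

lemma t_t: "t (t a) = a"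
  by (rule form_eqI) (simp add: form_t_left flip: adjoint_left)

lemma t_add: "t (a + b) = t a + t b"
  by (rule form_eqI) (simp add: form_t_left form_add form_add_right distrib_right)

lemma t_scale: "t (q *\<^sub>Q a) = q *\<^sub>Q t a"
  by (rule form_eqI) (simp add: form_t_left form_scale form_scale_right mult_scaleQ_left)

lemma t_mult: "t (a * b) = t b * t a"
  by (rule form_eqI) (simp add: form_t_left adjoint_left' mult.assoc)

text \<open>Paired with \<open>u\<close>, the right adjunction turns \<open>x * t a\<close> into
  \<open>u * a\<close> and the left one turns \<open>t a * x\<close> into \<open>a * u\<close>, both
  against \<open>x\<close>; these agree when \<open>a\<close> is central.\<close>

lemma t_central:
  assumes "\<And>x. a * x = x * a"
  shows "t a * x = x * t a"
proof (rule form_eqI)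
  fix u
  have "form (x * t a) u = form (u * a) x" by (metis adjoint_right form_sym)
  also have "\<dots> = form (t a * x) u" by (metis adjoint_left' assms form_sym)
  finally show "form (t a * x) u = form (x * t a) u" by simp
qed

text \<open>The adjoint of the tensor of \<open>a\<close> and \<open>z\<close> is the tensor of
  \<open>t a\<close> and \<open>cnj z\<close>. Mere existence survives differences, so
  \<open>t\<close> need not be extended to the complexification.\<close>

lemma h_adjoint_exists: "\<exists>u'. \<forall>x y. h (u * x) y = h x (u' * y)"
proof (induction u rule: tensor_induct)
  case zero
  then show ?case by (intro exI[of _ 0]) (simp add: h_zero_left h_zero_right)
next
  case (pure a z)
  have 1: "h (pure_tensor a z * pure_tensor b w) y = h (pure_tensor b w) (pure_tensor (t a) (cnj z) * y)"
    for b w y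
    by (induction y rule: tensor_induct)
      (simp_all add: h_zero_right h_diff_right h_pure times_pure_tensor adjoint_left
        right_diff_distrib mult_ac)
  have "h (pure_tensor a z * x) y = h x (pure_tensor (t a) (cnj z) * y)" for x y
    by (induction x rule: tensor_induct)
      (simp_all add: h_zero_left h_diff_left 1 right_diff_distrib)
  then show ?case by blast
next
  case (diff u v)
  then obtain u' v' where "\<forall>x y. h (u * x) y = h x (u' * y)" "\<forall>x y. h (v * x) y = h x (v' * y)"
    by blast
  then show ?case
    by (intro exI[of _ "u' - v'"]) (simp add: left_diff_distrib h_diff_left h_diff_right)
qed

text \<open>Such an element \<open>u\<close> squares to zero for degree reasons, so with \<open>u'\<close> the adjoint of \<open>u\<close>
  the operator \<open>u' u\<close> is selfadjoint of square zero. It preserves each \<open>H\<^sup>p\<^sup>q\<close>, where \<open>h\<close> is definite,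
  hence it vanishes, and then so does \<open>u\<close>.\<close>

lemma central_20_eq_0:
  assumes u: "u \<in> Hdg 2 0" and comm: "\<And>y. u * y = y * u"
  shows "u = 0"
proof -
  obtain u' where u': "\<And>x y. h (u * x) y = h x (u' * y)"
    using h_adjoint_exists by blast
  have "u * u \<in> Hdg 3 (-1)" using mult_bidegree[OF u u] by simp
  then have uu: "u * u = 0" by (simp add: Hdg_trivial)
  have hom: "u * x = 0" if x: "x \<in> Hdg p q" for x p q
  proof -
    have deg: "u * y \<in> Hdg (r + 1) (s - 1)" if "y \<in> Hdg r s" for y r s
      using mult_bidegree[OF u that] by (simp add: algebra_simps)
    let ?z = "u' * (u * x)"
    have "u * ?z = u' * ((u * u) * x)" by (metis comm mult.assoc)
    then have "u * ?z = 0" by (simp add: uu)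
    \<comment> \<open>No bidegree of \<open>u'\<close> is established. Instead \<open>h y ?z\<close>
      equals \<open>h (u * y) (u * x)\<close>, and multiplication by \<open>u\<close> shifts all
      types equally, so distinct types stay distinct and hence orthogonal.\<close>
    have "?z = 0"
    proof (rule isotropic_orthogonal_eq_0[of p q])
      fix r s y assume "(r, s) \<noteq> (p, q)" "y \<in> Hdg r s"
      then show "h y ?z = 0"
        using Hdg_orthogonal[OF _ deg deg, of r s p q y x] x by (simp flip: u')
    next
      show "h ?z ?z = 0"
        using u'[of ?z "u * x"] \<open>u * ?z = 0\<close> by (simp add: h_zero_left)
    qed
    then have "h (u * x) (u * x) = 0" by (simp add: u' h_zero_right)
    then show ?thesis using h_definite deg[OF x] by blast
  qed
  obtain a b c where "a \<in> Hdg 2 0" "b \<in> Hdg 1 1" "c \<in> Hdg 0 2" "pure_tensor 1 1 = a + b + c"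
    by (rule Hdg_decompose)
  then have "u * pure_tensor 1 1 = 0" by (simp add: distrib_left hom)
  then show ?thesis by (simp add: pure_tensor_one_times)
qed

text \<open>For homogeneous \<open>y\<close> the products of \<open>u\<close>, \<open>v\<close>,
  \<open>w\<close> with \<open>y\<close> have three different types, and these are the same on
  either side of \<open>y\<close>. Comparing components of the commutation relation therefore makes
  \<open>u\<close> itself commute with \<open>y\<close>.\<close>

lemma central_in_Hdg_11:
  assumes "\<And>x. a * x = x * a"
  shows "pure_tensor a 1 \<in> Hdg 1 1"
proof -
  let ?X = "pure_tensor a (1::complex)"
  obtain u v w where uvw: "u \<in> Hdg 2 0" "v \<in> Hdg 1 1" "w \<in> Hdg 0 2" "?X = u + v + w"
    by (rule Hdg_decompose)
  have comm: "?X * y = y * ?X" for y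
    by (induction y rule: tensor_induct) (simp_all add: times_pure_tensor assms algebra_simps)
  have eq: "u * y + v * y + w * y = y * u + y * v + y * w" for y
    using comm[of y] by (simp add: uvw(4) algebra_simps)
  have deg: "x * y \<in> Hdg p' q'" if "x \<in> Hdg p q" "y \<in> Hdg r s" "p' = p + r - 1" "q' = q + s - 1"
    for x y p q r s p' q'
    using mult_bidegree[OF that(1,2)] that(3,4) by simp
  have "u * y = y * u" if y: "y \<in> Hdg 2 0" for y
    using deg[OF uvw(1) y, of 3 "-1"] deg[OF y uvw(1), of 3 "-1"] by (simp add: Hdg_trivial)
  moreover have "u * y = y * u" if y: "y \<in> Hdg 1 1" for y
    using Hdg_unique(1)[OF deg[OF uvw(1) y] deg[OF uvw(2) y] deg[OF uvw(3) y]
      deg[OF y uvw(1)] deg[OF y uvw(2)] deg[OF y uvw(3)] eq] by simp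
  moreover have "u * y = y * u" if y: "y \<in> Hdg 0 2" for y
  proof -
    have "w * y = 0" "y * w = 0"
      using deg[OF uvw(3) y, of "-1" 3] deg[OF y uvw(3), of "-1" 3] by (simp_all add: Hdg_trivial)
    \<comment> \<open>Here \<open>u * y\<close> has type (1,1) and \<open>v * y\<close> type (0,2),
      so the (2,0) slot is filled with 0 and \<open>u * y\<close> is compared in the middle
      slot.\<close>
    then have "0 + u * y + v * y = 0 + y * u + y * v" using eq[of y] by simp
    then show ?thesis
      using Hdg_unique(2)[OF Hdg_zero deg[OF uvw(1) y] deg[OF uvw(2) y]
        Hdg_zero deg[OF y uvw(1)] deg[OF y uvw(2)]] by simp
  qed
  ultimately have "u * y = y * u" for y
    by (rule_tac x = y in Hdg_decompose) (simp add: algebra_simps)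
  then have "u = 0" by (rule central_20_eq_0[OF uvw(1)])
  \<comment> \<open>The tensor of \<open>a\<close> and 1 is real and conjugation exchanges the outer
    pieces, so \<open>u\<close> is the conjugate of \<open>w\<close> and both vanish
    together.\<close>
  have "w \<in> cconj ` Hdg 2 0" using uvw(3) by (simp add: cconj_Hdg_20)
  then have "cconj w \<in> Hdg 2 0" by (auto simp: cconj_cconj)
  moreover have "cconj v \<in> Hdg 1 1" "cconj u \<in> Hdg 0 2"
    using uvw cconj_Hdg_11 cconj_Hdg_20 by blast+
  moreover have "cconj w + cconj v + cconj u = u + v + w"
    using uvw(4) by (metis cconj_add cconj_pure complex_cnj_one add.commute add.assoc)
  ultimately have "cconj w = u" using uvw(1-3) Hdg_unique(1) by blast
  then have "w = 0" using cconj_cconj[of w] by (simp add: \<open>u = 0\<close> cconj_zero)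
  then show ?thesis using uvw \<open>u = 0\<close> by simp
qed

lemma form_negative_central:
  assumes "\<And>x. a * x = x * a" and "a \<noteq> 0"
  shows "form a a < 0"
proof -
  have "pure_tensor a (1::complex) \<noteq> 0" using pure_tensor_one_eq_0 assms(2) by blast
  then have "Re (h (pure_tensor a 1) (pure_tensor a 1)) < 0"
    using negative_11 central_in_Hdg_11[OF assms(1)] by (simp add: negative_definite_on_def)
  moreover have "Re (of_rat q) = of_rat q" for q by (cases q) (simp add: of_rat_rat)
  ultimately show ?thesis by (simp add: h_pure)
qed

end

section \<open>Products of number fields\<close>

text \<open>\<open>RDirProd_list\<close> is built from nested pairs; prepending an entry is a ring
  homomorphism from the pair product, which yields the componentwise operations by
  induction.\<close>

lemma RDirProd_list_map_ops:
  assumes "\<And>i. i \<in> set is \<Longrightarrow> f i \<in> carrier (R i)" and "\<And>i. i \<in> set is \<Longrightarrow> g i \<in> carrier (R i)"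
  shows "map f is \<otimes>\<^bsub>RDirProd_list (map R is)\<^esub> map g is = map (\<lambda>i. f i \<otimes>\<^bsub>R i\<^esub> g i) is \<and>
    map f is \<oplus>\<^bsub>RDirProd_list (map R is)\<^esub> map g is = map (\<lambda>i. f i \<oplus>\<^bsub>R i\<^esub> g i) is"
  using assms
proof (induction "is")
  case Nil
  show ?case by (simp add: monoid.defs)
next
  case (Cons i js)
  let ?Rs = "RDirProd_list (map R js)"
  have c: "(f i, map f js) \<in> carrier (RDirProd (R i) ?Rs)" "(g i, map g js) \<in> carrier (RDirProd (R i) ?Rs)"
    using Cons.prems by (auto simp: RDirProd_carrier intro!: RDirProd_list_carrier_memI)
  note hom = RDirProd_list_hom1[of "R i" "map R js"]
  show ?case
    using ring_hom_mult[OF hom c] ring_hom_add[OF hom c] Cons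
    by (simp add: RDirProd_def DirProd_def monoid.defs)
qed

text \<open>The common shape of the center and of its invariant part, so that one structure theory
  serves both.\<close>

definition ring_on :: "'a::{ring, monoid_mult} set \<Rightarrow> 'a ring" where
  "ring_on A = \<lparr>carrier = A, monoid.mult = (*), one = 1, ring.zero = 0, add = (+)\<rparr>"

lemma factor_ring_on:
  "factor_ring (ring_on A) e =
    \<lparr>carrier = (\<lambda>x. e * x) ` A, monoid.mult = (*), one = e, ring.zero = 0, add = (+)\<rparr>"
  by (simp add: factor_ring_def ring_on_def)

lemma linear_mult: "Vector_Spaces.linear scaleQ scaleQ ((*) (x::'a::rat_algebra))"
  by unfold_locales (simp_all add: distrib_left mult_scaleQ_right)

lemma idempotent_rat_hom:
  assumes "field (factor_ring (ring_on A) (e::'a::rat_algebra))" "rat_vector.subspace ((\<lambda>x. e * x) ` A)"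
  shows "(\<lambda>q. q *\<^sub>Q e) \<in> ring_hom ring_of_type_algebra (factor_ring (ring_on A) e)"
proof -
  interpret field "factor_ring (ring_on A) e" by fact
  have "e \<in> (\<lambda>x. e * x) ` A" "e * e = e"
    using one_closed l_one[OF one_closed] by (simp_all add: factor_ring_on)
  then show ?thesis
    using rat_vector.subspace_scale[OF assms(2)]
    by (auto intro!: ring_hom_memI simp: factor_ring_on ring_of_type_algebra_def scaleQ_add_left
        mult_scaleQ_left mult_scaleQ_right scaleQ_scaleQ scaleQ_one)
qed

text \<open>\<open>number_field\<close> measures dimension by \<open>Span\<close> over the image of
  the rationals, which consists of the multiples of \<open>e\<close>. Since \<open>e\<close> acts as
  the identity on the factor, \<open>(q *\<^sub>Q e) * u\<close> is \<open>q *\<^sub>Q u\<close>, so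
  \<open>Span\<close> agrees with the rational span and a vector space basis serves as the finite
  list.\<close>

lemma number_field_factorI:
  fixes e :: "'a::rat_algebra"
  assumes fin: "finite S" "rat_vector.span S = (UNIV :: 'a set)"
    and A: "rat_vector.subspace A"
    and field: "field (factor_ring (ring_on A) e)"
  shows "number_field (factor_ring (ring_on A) e)"
proof -
  let ?L = "factor_ring (ring_on A) e" and ?E = "(\<lambda>x. e * x) ` A"
  have sub: "rat_vector.subspace ?E"
    using module_hom.subspace_image[of scaleQ scaleQ "(*) e", OF _ A] linear_mult[of e]
    by (simp add: module_hom_iff_linear)
  let ?\<iota> = "\<lambda>q. q *\<^sub>Q e"
  have hom: "?\<iota> \<in> ring_hom (ring_of_type_algebra :: rat ring) ?L"
    by (rule idempotent_rat_hom[OF field sub])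
  interpret L: field ?L by fact
  have E: "e \<in> ?E" "e * e = e"
    using L.one_closed L.l_one[OF L.one_closed] by (simp_all add: factor_ring_on)
  then have id: "e * x = x" if "x \<in> ?E" for x using that by (auto simp flip: mult.assoc)
  interpret Q: field "ring_of_type_algebra :: rat ring" by rule
  interpret h: ring_hom_ring "ring_of_type_algebra :: rat ring" ?L ?\<iota>
    by (rule ring_hom_ringI2) (fact Q.ring_axioms L.ring_axioms hom)+
  have "subfield (?\<iota> ` carrier ring_of_type_algebra) ?L"
    by (rule h.img_is_subfield(2)[OF Q.carrier_is_subfield]) simp
  then have K: "subfield (range ?\<iota>) ?L" by (simp add: ring_of_type_algebra_def)
  have Span: "L.Span (range ?\<iota>) us = rat_vector.span (set us)" if "set us \<subseteq> ?E" for us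
    using that
  proof (induction us)
    case Nil
    show ?case by simp (simp add: factor_ring_on)
  next
    case (Cons u us)
    then have "u \<in> ?E" "set us \<subseteq> ?E" by simp_all
    then have u: "e * u = u" and IH: "L.Span (range ?\<iota>) us = rat_vector.span (set us)"
      using id Cons.IH by blast+
    show ?case
    proof (rule Set.set_eqI)
      fix x
      have "x \<in> L.Span (range ?\<iota>) (u # us) \<longleftrightarrow>
          (\<exists>q. \<exists>v \<in> rat_vector.span (set us). x = q *\<^sub>Q u + v)"
        unfolding IH[symmetric] by (simp add: L.line_extension_mem_iff)
          (simp add: factor_ring_on mult_scaleQ_left u)
      also have "\<dots> \<longleftrightarrow> (\<exists>q. x - q *\<^sub>Q u \<in> rat_vector.span (set us))"
        by (metis add.commute add_diff_cancel_left' diff_add_cancel)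
      also have "\<dots> \<longleftrightarrow> x \<in> rat_vector.span (set (u # us))"
        by (simp add: rat_vector.span_breakdown_eq)
      finally show "x \<in> L.Span (range ?\<iota>) (u # us) \<longleftrightarrow> x \<in> rat_vector.span (set (u # us))" .
    qed
  qed
  obtain T where T: "T \<subseteq> ?E" "rat_vector.independent T" "?E \<subseteq> rat_vector.span T"
    "card T = rat_vector.dim ?E"
    by (rule rat_vector.basis_exists)
  have "finite T"
    using rat_vector.independent_span_bound[OF fin(1) T(2)] fin(2) by simp
  then obtain us where us: "set us = T" using finite_list by blast
  have "rat_vector.span T \<subseteq> ?E" using rat_vector.span_minimal[OF T(1) sub] .
  then have "L.Span (range ?\<iota>) us = ?E" using Span[of us] T us by auto
  then have "L.finite_dimension (range ?\<iota>) (carrier ?L)"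
    using L.Span_finite_dimension[OF K, of us] us T(1) by (simp add: factor_ring_on)
  then show ?thesis unfolding number_field_def using field hom by blast
qed

section \<open>Commutative subalgebras and their corners\<close>

locale comm_rat_subalgebra =
  fixes A :: "'h::rat_algebra set"
  assumes finite_dimensional: "\<exists>S::'h set. finite S \<and> rat_vector.span S = UNIV"
    and subspace: "rat_vector.subspace A"
    and one_mem: "1 \<in> A"
    and mult_mem: "x \<in> A \<Longrightarrow> y \<in> A \<Longrightarrow> x * y \<in> A"
    and mult_comm: "x \<in> A \<Longrightarrow> y \<in> A \<Longrightarrow> x * y = y * x"
begin

lemmas zero_mem = rat_vector.subspace_0[OF subspace]
  and add_mem = rat_vector.subspace_add[OF subspace]
  and diff_mem = rat_vector.subspace_diff[OF subspace]
  and uminus_mem = rat_vector.subspace_neg[OF subspace]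
  and scale_mem = rat_vector.subspace_scale[OF subspace]

abbreviation corner :: "'h \<Rightarrow> 'h set" where "corner e \<equiv> (\<lambda>x. e * x) ` A"

lemma corner_iff:
  assumes "e \<in> A" "e * e = e"
  shows "x \<in> corner e \<longleftrightarrow> x \<in> A \<and> e * x = x"
  using assms mult_mem by (auto simp flip: mult.assoc intro: rev_image_eqI)

lemma subspace_corner: "rat_vector.subspace (corner e)"
  using module_hom.subspace_image[of scaleQ scaleQ "(*) e", OF _ subspace] linear_mult[of e]
  by (simp add: module_hom_iff_linear)

text \<open>\<open>finite_dimensional_vector_space\<close> fixes a basis, while this locale assumes
  only a finite spanning set, so a basis is extracted from that set inside the proof. The next lemma
  does the same.\<close>

lemma dim_eq_imp_subset_eq:
  assumes "rat_vector.subspace U" "rat_vector.subspace V" "U \<subseteq> V" "rat_vector.dim V \<le> rat_vector.dim (U :: 'h set)"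
  shows "U = V"
proof -
  obtain S :: "'h set" where S: "finite S" "rat_vector.span S = UNIV"
    using finite_dimensional by blast
  obtain B where B: "B \<subseteq> S" "rat_vector.independent B" "S \<subseteq> rat_vector.span B"
    by (rule rat_vector.basis_exists[of S])
  interpret fd: finite_dimensional_vector_space scaleQ B
  proof
    show "finite B" using B S finite_subset by blast
    show "rat_vector.span B = UNIV"
      using rat_vector.span_minimal[OF B(3)] S by auto
  qed (fact B)
  show ?thesis by (rule fd.subspace_dim_equal) (use assms in auto)
qed

lemma dim_image_inj:
  assumes "inj_on ((*) x) U" "rat_vector.subspace U"
  shows "rat_vector.dim ((*) x ` U) = rat_vector.dim (U :: 'h set)"
proof -
  obtain S :: "'h set" where S: "finite S" "rat_vector.span S = UNIV"
    using finite_dimensional by blast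
  obtain B where B: "B \<subseteq> S" "rat_vector.independent B" "S \<subseteq> rat_vector.span B"
    by (rule rat_vector.basis_exists[of S])
  interpret fd: finite_dimensional_vector_space scaleQ B
  proof
    show "finite B" using B S finite_subset by blast
    show "rat_vector.span B = UNIV"
      using rat_vector.span_minimal[OF B(3)] S by auto
  qed (fact B)
  interpret fd1: finite_dimensional_vector_space_pair_1 scaleQ B scaleQ
    by unfold_locales
  have "rat_vector.span U = U" using assms(2) by (simp add: rat_vector.span_eq_iff)
  then have "inj_on ((*) x) (rat_vector.span U)" by (metis assms(1))
  then show ?thesis by (rule fd1.dim_image_eq[OF linear_mult])
qed

lemma cring_corner:
  assumes e: "e \<in> A" "e * e = e"
  shows "cring (factor_ring (ring_on A) e)"
proof (rule cringI)
  note c = corner_iff[OF e]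
  show "abelian_group (factor_ring (ring_on A) e)"
  proof (rule abelian_groupI)
    fix x assume x: "x \<in> carrier (factor_ring (ring_on A) e)"
    then show "\<exists>y\<in>carrier (factor_ring (ring_on A) e). y \<oplus>\<^bsub>factor_ring (ring_on A) e\<^esub> x = \<zero>\<^bsub>factor_ring (ring_on A) e\<^esub>"
      by (intro bexI[of _ "- x"]) (simp_all add: factor_ring_on c uminus_mem)
  qed (simp_all add: factor_ring_on c add_mem zero_mem algebra_simps)
  have closed: "e * (x * y) = x * y" if "e * x = x" for x y
    using that by (metis mult.assoc)
  show "comm_monoid (factor_ring (ring_on A) e)"
  proof (rule comm_monoidI)
    fix x y assume "x \<in> carrier (factor_ring (ring_on A) e)" "y \<in> carrier (factor_ring (ring_on A) e)"
    then show "x \<otimes>\<^bsub>factor_ring (ring_on A) e\<^esub> y = y \<otimes>\<^bsub>factor_ring (ring_on A) e\<^esub> x"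
      by (simp add: factor_ring_on c mult_comm)
  qed (simp_all add: factor_ring_on c mult_mem e closed mult.assoc)
qed (simp add: factor_ring_on distrib_right)

lemma field_cornerI:
  assumes e: "e \<in> A" "e * e = e" "e \<noteq> 0"
    and inv: "\<And>x. x \<in> corner e \<Longrightarrow> x \<noteq> 0 \<Longrightarrow> \<exists>y\<in>corner e. x * y = e"
  shows "field (factor_ring (ring_on A) e)"
proof -
  interpret cring "factor_ring (ring_on A) e" by (rule cring_corner[OF e(1,2)])
  show ?thesis
    by (rule cring_fieldI2) (use e inv in \<open>simp_all add: factor_ring_on\<close>)
qed

lemma number_field_cornerI:
  assumes "field (factor_ring (ring_on A) e)"
  shows "number_field (factor_ring (ring_on A) e)"
  using number_field_factorI[OF _ _ subspace assms] finite_dimensional by blast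

text \<open>\<open>sorted_wrt\<close> constrains each pair of positions in one order; commutativity
  supplies the other. In this form orthogonality passes easily to concatenated lists.\<close>

lemma ring_product_byI:
  assumes es: "set es \<subseteq> A" "sum_list es = 1" "\<And>e. e \<in> set es \<Longrightarrow> e * e = e"
    and orth: "sorted_wrt (\<lambda>e f. e * f = 0) es"
  shows "ring_product_by (ring_on A) es"
proof -
  let ?\<phi> = "\<lambda>x. map (\<lambda>e. e * x) es" and ?P = "RDirProd_list (map (factor_ring (ring_on A)) es)"
  have o: "es ! i * es ! j = 0" if "i < length es" "j < length es" "i \<noteq> j" for i j
  proof -
    have "es ! i \<in> A" "es ! j \<in> A" using es that by auto
    moreover have "es ! i * es ! j = 0 \<or> es ! j * es ! i = 0"
      using sorted_wrt_nth_less[OF orth] that by (metis linorder_neqE_nat)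
    ultimately show ?thesis using mult_comm by metis
  qed
  have comp: "x = (\<Sum>e\<leftarrow>es. e * x)" for x
    using sum_list_mult_const[of "\<lambda>e. e" x es] es(2) by simp
  have "?\<phi> \<in> ring_hom (ring_on A) ?P"
  proof (rule ring_hom_memI)
    fix x assume "x \<in> carrier (ring_on A)"
    then show "?\<phi> x \<in> carrier ?P"
      by (intro RDirProd_list_carrier_memI) (simp_all add: ring_on_def factor_ring_def)
  next
    fix x y assume xy: "x \<in> carrier (ring_on A)" "y \<in> carrier (ring_on A)"
    have "e * (x * y) = e * x * (e * y)" if "e \<in> set es" for e
    proof -
      have "e \<in> A" using es(1) that by auto
      then have "e * x * (e * y) = (e * e) * (x * y)"
        using xy mult_comm[of e x] by (simp add: mult.assoc ring_on_def) (metis mult.assoc)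
      then show ?thesis using es(3)[OF that] by simp
    qed
    then show "?\<phi> (x \<otimes>\<^bsub>ring_on A\<^esub> y) = ?\<phi> x \<otimes>\<^bsub>?P\<^esub> ?\<phi> y"
      using xy by (subst RDirProd_list_map_ops[THEN conjunct1]) (simp_all add: ring_on_def factor_ring_def)
    show "?\<phi> (x \<oplus>\<^bsub>ring_on A\<^esub> y) = ?\<phi> x \<oplus>\<^bsub>?P\<^esub> ?\<phi> y"
      using xy by (subst RDirProd_list_map_ops[THEN conjunct2]) (simp_all add: ring_on_def factor_ring_def distrib_left)
  next
    have "\<one>\<^bsub>?P\<^esub> = es"
      unfolding RDirProd_list_one by (induction es) (simp_all add: factor_ring_def)
    then show "?\<phi> \<one>\<^bsub>ring_on A\<^esub> = \<one>\<^bsub>?P\<^esub>" by (simp add: ring_on_def)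
  qed
  moreover have "bij_betw ?\<phi> (carrier (ring_on A)) (carrier ?P)"
  proof (rule bij_betw_imageI)
    show "inj_on ?\<phi> (carrier (ring_on A))"
      by (rule inj_onI) (metis comp)
    show "?\<phi> ` carrier (ring_on A) = carrier ?P"
    proof (intro equalityI subsetI)
      fix a assume "a \<in> ?\<phi> ` carrier (ring_on A)"
      then show "a \<in> carrier ?P" using \<open>?\<phi> \<in> ring_hom (ring_on A) ?P\<close> by (auto simp: ring_hom_def)
    next
      fix a assume a: "a \<in> carrier ?P"
      let ?n = "length es"
      have len: "length a = ?n" using RDirProd_list_carrier_mem(1)[OF a] by simp
      have ai: "a ! i \<in> corner (es ! i)" if "i < ?n" for i
        using RDirProd_list_carrier_mem(2)[OF a, of i] that by (simp add: factor_ring_def ring_on_def)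
      then have aA: "a ! i \<in> A" and aid: "es ! i * a ! i = a ! i" if "i < ?n" for i
        using corner_iff[of "es ! i" "a ! i"] ai[OF that] nth_mem[OF that] es by blast+
      \<comment> \<open>The preimage of a tuple is the sum of its entries: multiplying by
        \<open>es ! i\<close> keeps the entry at \<open>i\<close> and kills all others, since
        \<open>a ! j\<close> is a multiple of \<open>es ! j\<close>.\<close>
      define z where "z = (\<Sum>j<?n. a ! j)"
      have "es ! i * z = a ! i" if i: "i < ?n" for i
      proof -
        have "es ! i * a ! j = (if j = i then a ! i else 0)" if "j < ?n" for j
          using aid[OF that] o[OF i that] aid[OF i] by (auto, metis mult.assoc mult_zero_left)
        then have "(\<Sum>j<?n. es ! i * a ! j) = (\<Sum>j<?n. if j = i then a ! i else 0)"
          by (intro sum.cong) auto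
        also have "\<dots> = a ! i" using i by simp
        finally show ?thesis by (simp add: z_def sum_distrib_left)
      qed
      then have "a = ?\<phi> z" using len by (intro nth_equalityI) auto
      moreover have "z \<in> A" unfolding z_def using aA by (intro rat_vector.subspace_sum[OF subspace]) auto
      ultimately show "a \<in> ?\<phi> ` carrier (ring_on A)"
        by (intro image_eqI[of _ _ z]) (simp_all add: ring_on_def)
    qed
  qed
  ultimately show ?thesis
    using es(1) by (simp add: ring_product_by_def ring_iso_def ring_on_def)
qed

end

section \<open>Splitting a reduced algebra into fields\<close>

locale reduced_comm_rat_subalgebra = comm_rat_subalgebra +
  assumes reduced: "x \<in> A \<Longrightarrow> x * x = 0 \<Longrightarrow> x = 0"
begin

text \<open>Multiplication by \<open>x\<close> is injective on the finite-dimensional space \<open>xA\<close>, hence onto.\<close>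

lemma von_Neumann_regular:
  assumes x: "x \<in> A"
  shows "\<exists>y\<in>A. x = x * x * y"
proof -
  have sub: "(*) x ` corner x \<subseteq> corner x"
    using mult_mem[OF x] by (auto simp: image_image)
  have "inj_on ((*) x) (corner x)"
  proof (rule inj_onI)
    fix u v assume "u \<in> corner x" "v \<in> corner x" "x * u = x * v"
    then obtain a b where ab: "a \<in> A" "b \<in> A" "u = x * a" "v = x * b" by blast
    define r where "r = a - b"
    have r: "r \<in> A" "u - v = x * r" "x * (u - v) = 0"
      using ab \<open>x * u = x * v\<close> by (simp_all add: r_def right_diff_distrib diff_mem)
    \<comment> \<open>The difference is \<open>x * r\<close> and is killed by \<open>x\<close>, so
      it squares to zero; this is where reducedness makes multiplication by \<open>x\<close>
      injective.\<close>
    have "(u - v) * (u - v) = r * (x * (u - v))"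
      using r mult_comm[OF x r(1)] by (simp add: mult.assoc)
    then have "u - v = 0" using reduced[of "u - v"] r mult_mem[OF x r(1)] by simp
    then show "u = v" by simp
  qed
  then have "rat_vector.dim ((*) x ` corner x) = rat_vector.dim (corner x)"
    by (rule dim_image_inj) (rule subspace_corner)
  moreover have "rat_vector.subspace ((*) x ` corner x)"
    using module_hom.subspace_image[of scaleQ scaleQ "(*) x", OF _ subspace_corner] linear_mult[of x]
    by (simp add: module_hom_iff_linear)
  ultimately have "(*) x ` corner x = corner x"
    by (intro dim_eq_imp_subset_eq subspace_corner sub) simp_all
  moreover have "x \<in> corner x" using one_mem by (intro rev_image_eqI[of 1]) simp_all
  ultimately show ?thesis by (force simp: mult.assoc)
qed

text \<open>If the corner of \<open>e\<close> is not a field, take \<open>x\<close> nonzero in it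
  without inverse and write \<open>x = x * x * y\<close>. Then \<open>f = x * y\<close> is
  idempotent; it is nonzero because \<open>f * x = x\<close>, and differs from \<open>e\<close>
  because otherwise \<open>e * y\<close> would invert \<open>x\<close>. So \<open>e\<close> splits
  as \<open>f + g\<close>, and the induction continues on two smaller corners.\<close>

lemma corner_decomposition:
  assumes "e \<in> A" "e * e = e"
  shows "\<exists>es. set es \<subseteq> A \<and> sum_list es = e \<and> sorted_wrt (\<lambda>f g. f * g = 0) es \<and>
    (\<forall>f\<in>set es. f * f = f \<and> e * f = f \<and> field (factor_ring (ring_on A) f))"
  using assms
proof (induction "rat_vector.dim (corner e)" arbitrary: e rule: less_induct)
  case less
  consider "e = 0" | "e \<noteq> 0" "\<And>x. x \<in> corner e \<Longrightarrow> x \<noteq> 0 \<Longrightarrow> \<exists>y\<in>corner e. x * y = e"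
    | x where "x \<in> corner e" "x \<noteq> 0" "\<And>y. y \<in> corner e \<Longrightarrow> x * y \<noteq> e" by blast
  then show ?case
  proof cases
    case 1
    then show ?thesis by (intro exI[of _ "[]"]) simp
  next
    case 2
    then show ?thesis using less.prems field_cornerI by (intro exI[of _ "[e]"]) simp
  next
    case 3
    note c = corner_iff[OF less.prems]
    have x: "x \<in> A" "e * x = x" using 3(1) c by auto
    obtain y where y: "y \<in> A" "x = x * x * y" using von_Neumann_regular[OF x(1)] by blast
    define f where "f = x * y"
    define g where "g = e - f"
    have fA: "f \<in> A" by (simp add: f_def x y(1) mult_mem)
    have gA: "g \<in> A" by (simp add: g_def fA less.prems diff_mem)
    have fx: "f * x = x" using y(2) mult_comm[OF x(1) y(1)] by (metis f_def mult.assoc)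
    have ff: "f * f = f" using fx by (metis f_def mult.assoc)
    have ef: "e * f = f" using x by (simp add: f_def flip: mult.assoc)
    have fe: "f * e = f" using ef mult_comm[OF fA less.prems(1)] by simp
    have gg: "g * g = g" and fg: "f * g = 0" and gf: "g * f = 0" and eg: "e * g = g"
      by (simp_all add: g_def algebra_simps ff ef fe less.prems)
    have "f \<noteq> 0" using fx 3(2) by auto
    have "g \<noteq> 0"
    proof
      assume "g = 0"
      then have "x * (e * y) = e"
        using x mult_comm[OF x(1) less.prems(1)] by (simp add: g_def f_def flip: mult.assoc)
      then show False using 3(3)[of "e * y"] y by blast
    qed
    \<comment> \<open>The dimension drops because the complementary idempotent \<open>l\<close> lies
      in the corner of \<open>e\<close> but is killed by \<open>k\<close>.\<close>
    have smaller: "rat_vector.dim (corner k) < rat_vector.dim (corner e)"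
      if k: "k \<in> A" "k * k = k" "e * k = k" and l: "l \<in> A" "e * l = l" "k * l = 0" "l \<noteq> 0" for k l
    proof (rule ccontr)
      assume "\<not> ?thesis"
      moreover have "corner k \<subseteq> corner e"
      proof
        fix z assume "z \<in> corner k"
        then have z: "z \<in> A" "k * z = z" using corner_iff[OF k(1,2)] by auto
        then have "e * z = z" using k(3) by (metis mult.assoc)
        then show "z \<in> corner e" using z c by simp
      qed
      ultimately have "corner k = corner e"
        by (intro dim_eq_imp_subset_eq subspace_corner) simp_all
      moreover have "l \<in> corner e" using l c by simp
      ultimately show False using corner_iff[OF k(1,2), of l] l by simp
    qed
    obtain es where es: "set es \<subseteq> A" "sum_list es = f" "sorted_wrt (\<lambda>f g. f * g = 0) es"
      "\<And>k. k \<in> set es \<Longrightarrow> k * k = k \<and> f * k = k \<and> field (factor_ring (ring_on A) k)"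
      using less.hyps[OF smaller[OF fA ff ef gA eg fg \<open>g \<noteq> 0\<close>] fA ff] by blast
    obtain es' where es': "set es' \<subseteq> A" "sum_list es' = g" "sorted_wrt (\<lambda>f g. f * g = 0) es'"
      "\<And>k. k \<in> set es' \<Longrightarrow> k * k = k \<and> g * k = k \<and> field (factor_ring (ring_on A) k)"
      using less.hyps[OF smaller[OF gA gg eg fA ef gf \<open>f \<noteq> 0\<close>] gA gg] by blast
    have "k * k' = 0" if "k \<in> set es" "k' \<in> set es'" for k k'
    proof -
      have "k \<in> A" using that es(1) by auto
      then have "k * k' = (k * f) * (g * k')"
        using es(4)[OF that(1)] es'(4)[OF that(2)] mult_comm[OF _ fA] by simp
      also have "\<dots> = k * (f * g) * k'" by (simp add: mult.assoc)
      finally show ?thesis by (simp add: fg)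
    qed
    moreover have "e * k = k" if "k \<in> set es \<union> set es'" for k
      using that es(4)[of k] es'(4)[of k] ef eg by (metis UnE mult.assoc)
    moreover have "f + g = e" by (simp add: g_def)
    ultimately show ?thesis
      using es es' by (intro exI[of _ "es @ es'"]) (auto simp: sorted_wrt_append)
  qed
qed

theorem product_of_number_fields:
  "\<exists>es. ring_product_by (ring_on A) es \<and> (\<forall>e\<in>set es. number_field (factor_ring (ring_on A) e))"
proof -
  obtain es where "set es \<subseteq> A" "sum_list es = 1" "sorted_wrt (\<lambda>f g. f * g = 0) es"
    "\<And>f. f \<in> set es \<Longrightarrow> f * f = f \<and> field (factor_ring (ring_on A) f)"
    using corner_decomposition[OF one_mem] by auto
  then show ?thesis using ring_product_byI[of es] number_field_cornerI by blast
qed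

end

section \<open>Positive involutions\<close>

text \<open>Elements of \<open>ring_hom\<close> are not assumed to be linear over the rationals;
  this is what makes them so in \<open>corner_homD\<close>.\<close>

lemma rat_ring_hom_eq_of_rat:
  fixes g :: "rat \<Rightarrow> 'f::field_char_0"
  assumes add: "\<And>p q. g (p + q) = g p + g q" and mult: "\<And>p q. g (p * q) = g p * g q" and one: "g 1 = 1"
  shows "g q = of_rat q"
proof -
  have 0: "g 0 = 0" using add[of 0 0] by simp
  have minus: "g (- p) = - g p" for p using add[of p "- p"] 0 by (simp add: eq_neg_iff_add_eq_0 add.commute)
  have nat: "g (of_nat n) = of_nat n" for n
    by (induction n) (simp_all add: 0 add one)
  have int: "g (of_int n) = of_int n" for n
    by (cases n) (simp_all add: nat minus del: of_nat_Suc)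
  obtain a b where q: "q = of_int a / of_int b" "b > 0"
    by (cases q) (simp add: Fract_of_int_quotient)
  then have "g (q * of_int b) = of_int a" using int by simp
  then have "g q * of_int b = of_int a" by (simp only: mult int)
  then have "g q = of_int a / of_int b" using q(2) by (simp add: eq_divide_eq)
  then show ?thesis by (simp add: q of_rat_divide)
qed

context comm_rat_subalgebra
begin

text \<open>For the scalar rule, \<open>q *\<^sub>Q x\<close> is \<open>(q *\<^sub>Q e) * x\<close>,
  and sending \<open>q\<close> to \<open>\<tau> (q *\<^sub>Q e)\<close> is a unital ring
  homomorphism on the rationals, hence \<open>of_rat\<close>.\<close>

lemma corner_homD:
  fixes \<tau> :: "'h \<Rightarrow> 'f::field_char_0"
  assumes field: "field (factor_ring (ring_on A) e)"
    and \<tau>: "\<tau> \<in> ring_hom (factor_ring (ring_on A) e) ring_of_type_algebra"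
  shows "x \<in> corner e \<Longrightarrow> y \<in> corner e \<Longrightarrow> \<tau> (x + y) = \<tau> x + \<tau> y"
    and "x \<in> corner e \<Longrightarrow> y \<in> corner e \<Longrightarrow> \<tau> (x * y) = \<tau> x * \<tau> y"
    and "\<tau> e = 1"
    and "x \<in> corner e \<Longrightarrow> \<tau> (q *\<^sub>Q x) = of_rat q * \<tau> x"
proof -
  interpret field "factor_ring (ring_on A) e" by fact
  show add: "\<tau> (x + y) = \<tau> x + \<tau> y" if "x \<in> corner e" "y \<in> corner e" for x y
    using ring_hom_add[OF \<tau>, of x y] that by (simp add: factor_ring_on ring_of_type_algebra_def)
  show mult: "\<tau> (x * y) = \<tau> x * \<tau> y" if "x \<in> corner e" "y \<in> corner e" for x y
    using ring_hom_mult[OF \<tau>, of x y] that by (simp add: factor_ring_on ring_of_type_algebra_def)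
  show one: "\<tau> e = 1"
    using ring_hom_one[OF \<tau>] by (simp add: factor_ring_on ring_of_type_algebra_def)
  have e: "e \<in> corner e" "e * e = e"
    using one_closed l_one[OF one_closed] by (simp_all add: factor_ring_on)
  have qe: "q *\<^sub>Q e \<in> corner e" for q using e(1) rat_vector.subspace_scale[OF subspace_corner] by blast
  show "\<tau> (q *\<^sub>Q x) = of_rat q * \<tau> x" if x: "x \<in> corner e" for q x
  proof -
    have "(q *\<^sub>Q e) * x = q *\<^sub>Q x"
      using l_one[of x] x by (simp add: factor_ring_on mult_scaleQ_left)
    moreover have "\<tau> (q *\<^sub>Q e) = of_rat q"
    proof (rule rat_ring_hom_eq_of_rat)
      show "\<tau> ((p + q) *\<^sub>Q e) = \<tau> (p *\<^sub>Q e) + \<tau> (q *\<^sub>Q e)" for p q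
        using add[OF qe qe] by (simp add: scaleQ_add_left)
      show "\<tau> ((p * q) *\<^sub>Q e) = \<tau> (p *\<^sub>Q e) * \<tau> (q *\<^sub>Q e)" for p q
        using mult[OF qe qe, of q p]
        by (simp add: mult_scaleQ_left mult_scaleQ_right scaleQ_scaleQ e mult.commute)
    qed (simp add: scaleQ_one one)
    ultimately show ?thesis using mult[OF qe x, of q] by simp
  qed
qed

lemma corner_inverse:
  assumes "field (factor_ring (ring_on A) e)" "x \<in> corner e" "x \<noteq> 0"
  shows "\<exists>y\<in>corner e. x * y = e"
proof -
  interpret field "factor_ring (ring_on A) e" by fact
  have "x \<in> Units (factor_ring (ring_on A) e)"
    using assms by (simp add: field_Units) (simp add: factor_ring_on)
  then show ?thesis by (auto simp: Units_def factor_ring_on)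
qed

text \<open>Idempotency of \<open>e\<close> is never a hypothesis in the final theorem; it is read
  off from \<open>e\<close> being the unit of its factor.\<close>

lemma field_corner_idem:
  assumes "field (factor_ring (ring_on A) e)" and "e \<in> A"
  shows "e * e = e" and "e \<in> corner e" and "e \<noteq> 0"
proof -
  interpret field "factor_ring (ring_on A) e" by fact
  show "e * e = e" "e \<in> corner e" "e \<noteq> 0"
    using one_closed l_one[OF one_closed] one_not_zero by (simp_all add: factor_ring_on)
qed

end

text \<open>Isolates what the Hodge structure contributes: \<open>A\<close> will be the center and
  \<open>B\<close> the negative of \<open>form\<close>. Positivity and multiplicativity of
  \<open>t\<close> are demanded on \<open>A\<close> only, because outside the center
  \<open>form\<close> is indefinite in general and \<open>t\<close> reverses products.\<close>

locale positive_involutive_algebra = comm_rat_subalgebra A for A :: "'h::rat_algebra set" +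
  fixes B :: "'h \<Rightarrow> 'h \<Rightarrow> rat" and t :: "'h \<Rightarrow> 'h"
  assumes B_sym: "B x y = B y x"
    and B_add: "B (x + x') y = B x y + B x' y"
    and B_scale: "B (q *\<^sub>Q x) y = q * B x y"
    and B_pos: "x \<in> A \<Longrightarrow> x \<noteq> 0 \<Longrightarrow> B x x > 0"
    and t_mem: "x \<in> A \<Longrightarrow> t x \<in> A"
    and t_add: "t (x + y) = t x + t y"
    and t_scale: "t (q *\<^sub>Q x) = q *\<^sub>Q t x"
    and t_mult: "x \<in> A \<Longrightarrow> y \<in> A \<Longrightarrow> t (x * y) = t x * t y"
    and t_t: "t (t x) = x"
    and adjoint: "a \<in> A \<Longrightarrow> x \<in> A \<Longrightarrow> y \<in> A \<Longrightarrow> B (a * x) y = B x (t a * y)"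
begin

lemma t_zero: "t 0 = 0"
  using t_add[of 0 0] by simp

lemma t_minus: "t (- x) = - t x"
  using t_add[of x "- x"] by (simp add: t_zero eq_neg_iff_add_eq_0 add.commute)

lemma t_diff: "t (x - y) = t x - t y"
  using t_add[of x "- y"] by (simp add: t_minus)

lemma t_one: "t 1 = 1"
  using t_mult[of 1 "t 1"] t_mem[OF one_mem] by (simp add: t_t one_mem)

lemma B_zero: "B 0 y = 0" "B y 0 = 0"
  using B_add[of 0 0 y] by (simp_all add: B_sym[of y])

lemma B_minus: "B (- x) y = - B x y" 
  using B_add[of x "- x" y] by (simp add: B_zero)

lemma B_diff: "B (x - x') y = B x y - B x' y"
  using B_add[of x "- x'" y] by (simp add: B_minus)

lemma B_sum: "B (sum f S) y = (\<Sum>s\<in>S. B (f s) y)"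
  by (induction S rule: infinite_finite_induct) (simp_all add: B_zero B_add)

text \<open>By adjunction \<open>B x x\<close> equals \<open>B 1 (t x * x)\<close>, so a vanishing
  norm contradicts positivity.\<close>

lemma norm_eq_0_iff: "x \<in> A \<Longrightarrow> x * t x = 0 \<longleftrightarrow> x = 0"
  using adjoint[of x 1 x] B_pos[of x] mult_comm[of x "t x"]
  by (cases "x = 0") (auto simp: one_mem t_mem B_zero)

sublocale reduced_comm_rat_subalgebra A
proof
  fix x assume x: "x \<in> A" "x * x = 0"
  \<comment> \<open>The norm of \<open>x\<close> is fixed by \<open>t\<close>, so its own norm is
    its square, which contains the factor \<open>x * x\<close>. Thus \<open>norm_eq_0_iff\<close>
    applies first to \<open>?b\<close> and then to \<open>x\<close>.\<close>
  let ?b = "x * t x"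
  have b: "?b \<in> A" "t ?b = ?b"
    using x mult_comm by (simp_all add: mult_mem t_mem t_mult t_t)
  have "?b * t ?b = (x * x) * (t x * t x)"
    using b(2) mult_comm[of x "t x"] x(1) t_mem by (simp add: mult.assoc) (metis mult.assoc)
  then have "?b = 0" using norm_eq_0_iff[OF b(1)] x(2) by simp
  then show "x = 0" using norm_eq_0_iff x(1) by simp
qed

abbreviation Ainv where "Ainv \<equiv> {a \<in> A. t a = a}"

text \<open>A second instance of the structure theory, now for the fixed elements:
  \<open>inv.corner e\<close> is \<open>e\<close> times \<open>Ainv\<close>, whereas
  \<open>corner e\<close> is \<open>e\<close> times \<open>A\<close>.\<close>

sublocale inv: reduced_comm_rat_subalgebra Ainv
proof
  show "rat_vector.subspace Ainv"
    by (rule rat_vector.subspaceI) (auto simp: zero_mem add_mem scale_mem t_zero t_add t_scale)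
  show "x * y \<in> Ainv" if "x \<in> Ainv" "y \<in> Ainv" for x y
    using that by (simp add: mult_mem t_mult)
qed (use finite_dimensional one_mem t_one mult_comm reduced in auto)

section \<open>Rational orthogonal bases and embeddings of the invariant part\<close>

lemma orthogonal_basis_span:
  assumes "finite S" "S \<subseteq> A"
  shows "\<exists>G. finite G \<and> G \<subseteq> A \<and> 0 \<notin> G \<and> rat_vector.span G = rat_vector.span S \<and>
    (\<forall>g\<in>G. \<forall>g'\<in>G. g \<noteq> g' \<longrightarrow> B g g' = 0)"
  using assms
proof (induction S rule: finite_induct)
  case empty
  show ?case by (intro exI[of _ "{}"]) simp
next
  case (insert a S)
  then have "S \<subseteq> A" by simp
  then obtain G where G: "finite G" "G \<subseteq> A" "0 \<notin> G" "rat_vector.span G = rat_vector.span S"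
    "\<And>g g'. g \<in> G \<Longrightarrow> g' \<in> G \<Longrightarrow> g \<noteq> g' \<Longrightarrow> B g g' = 0" using insert.IH by metis
  \<comment> \<open>A Gram-Schmidt step without normalisation: \<open>p\<close> is the orthogonal
    projection of \<open>a\<close> to the span of \<open>G\<close>, and \<open>a - p\<close> is
    added to \<open>G\<close> unless it is zero.\<close>
  define p where "p = (\<Sum>g\<in>G. (B a g / B g g) *\<^sub>Q g)"
  have p: "p \<in> rat_vector.span G"
    unfolding p_def by (intro rat_vector.span_sum rat_vector.span_scale rat_vector.span_base)
  have spans: "rat_vector.span (insert (a - p) G) = rat_vector.span (insert a S)"
  proof -
    have "rat_vector.span (insert (a - p) G) = rat_vector.span (insert a G)"
    proof (rule Set.set_eqI)
      fix x
      have "q *\<^sub>Q p \<in> rat_vector.span G" for q using p by (rule rat_vector.span_scale)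
      then have "x - q *\<^sub>Q a + q *\<^sub>Q p \<in> rat_vector.span G \<longleftrightarrow> x - q *\<^sub>Q a \<in> rat_vector.span G" for q
        by (rule rat_vector.span_add_eq2)
      moreover have "x - q *\<^sub>Q (a - p) = x - q *\<^sub>Q a + q *\<^sub>Q p" for q
        by (simp add: rat_vector.scale_right_diff_distrib)
      ultimately have "x - q *\<^sub>Q (a - p) \<in> rat_vector.span G \<longleftrightarrow> x - q *\<^sub>Q a \<in> rat_vector.span G" for q
        by metis
      then show "x \<in> rat_vector.span (insert (a - p) G) \<longleftrightarrow> x \<in> rat_vector.span (insert a G)"
        by (simp add: rat_vector.span_breakdown_eq)
    qed
    also have "\<dots> = rat_vector.span (insert a S)" using G(4) by (simp add: rat_vector.span_insert)
    finally show ?thesis .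
  qed
  have pA: "p \<in> A" unfolding p_def using G(2) by (intro rat_vector.subspace_sum[OF subspace] scale_mem) auto
  have ne: "B g g \<noteq> 0" if "g \<in> G" for g
    using B_pos[of g] that G(2,3) by (metis less_irrefl subsetD)
  have orth: "B (a - p) g = 0" if "g \<in> G" for g
  proof -
    have "B p g = (\<Sum>g'\<in>G. if g' = g then B a g else 0)"
      unfolding p_def B_sum B_scale using G(5) that ne by (intro sum.cong) auto
    also have "\<dots> = B a g" using that G(1) by simp
    finally show ?thesis by (simp add: B_diff)
  qed
  show ?case
  proof (cases "a - p = 0")
    case True
    then show ?thesis using G spans by (intro exI[of _ G]) simp
  next
    case False
    have "B g g' = 0" if "g \<in> insert (a - p) G" "g' \<in> insert (a - p) G" "g \<noteq> g'" for g g'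
      using that by (metis B_sym G(5) insert_iff orth)
    moreover have "insert (a - p) G \<subseteq> A" "finite (insert (a - p) G)" "0 \<notin> insert (a - p) G"
      using insert.prems pA G(1-3) False by (simp_all add: diff_mem)
    ultimately show ?thesis using spans by (intro exI[of _ "insert (a - p) G"]) blast
  qed
qed

text \<open>The error of the expansion lies in \<open>U\<close> and is orthogonal to
  \<open>G\<close>, hence to itself, so positivity makes it zero. Being a rational combination, the
  expansion can be pushed through any embedding.\<close>

lemma orthogonal_expansion:
  assumes U: "rat_vector.subspace U" "U \<subseteq> A"
  obtains G where "finite G" "G \<subseteq> U" "\<And>g. g \<in> G \<Longrightarrow> B g g > 0"
    "\<And>x. x \<in> U \<Longrightarrow> x = (\<Sum>g\<in>G. (B x g / B g g) *\<^sub>Q g)"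
proof -
  obtain T where T: "T \<subseteq> U" "rat_vector.independent T" "U \<subseteq> rat_vector.span T"
    "card T = rat_vector.dim U"
    by (rule rat_vector.basis_exists)
  have "finite T"
    using rat_vector.independent_span_bound[OF _ T(2)] finite_dimensional by blast
  moreover have "rat_vector.span T = U"
    using rat_vector.span_minimal[OF T(1) U(1)] T(3) by blast
  moreover have "T \<subseteq> A" using T(1) U(2) by blast
  ultimately obtain G where G: "finite G" "G \<subseteq> A" "0 \<notin> G" "rat_vector.span G = U"
    "\<And>g g'. g \<in> G \<Longrightarrow> g' \<in> G \<Longrightarrow> g \<noteq> g' \<Longrightarrow> B g g' = 0"
    using orthogonal_basis_span[of T] by metis
  have GU: "G \<subseteq> U" using G(4) rat_vector.span_superset by blast
  have pos: "B g g > 0" if "g \<in> G" for g using G(2,3) that by (intro B_pos) auto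
  then have ne: "B g g \<noteq> 0" if "g \<in> G" for g using that by force
  have exp: "x = (\<Sum>g\<in>G. (B x g / B g g) *\<^sub>Q g)" if x: "x \<in> U" for x
  proof -
    define y where "y = x - (\<Sum>g\<in>G. (B x g / B g g) *\<^sub>Q g)"
    have yU: "y \<in> U"
      unfolding y_def using GU x
      by (intro rat_vector.subspace_diff[OF U(1)] rat_vector.subspace_sum[OF U(1)]
          rat_vector.subspace_scale[OF U(1)]) auto
    have orth: "B y g = 0" if "g \<in> G" for g
    proof -
      have "(\<Sum>g'\<in>G. B x g' / B g' g' * B g' g) = (\<Sum>g'\<in>G. if g' = g then B x g else 0)"
        using G(5) that ne by (intro sum.cong) auto
      also have "\<dots> = B x g" using that G(1) by simp
      finally show ?thesis by (simp add: y_def B_diff B_sum B_scale)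
    qed
    have "rat_vector.subspace {z. B z y = 0}"
      by (rule rat_vector.subspaceI) (auto simp: B_zero B_add B_scale)
    moreover have "G \<subseteq> {z. B z y = 0}" using orth by (auto simp: B_sym[of _ y])
    ultimately have "B y y = 0"
      using rat_vector.span_minimal[of G "{z. B z y = 0}"] G(4) yU by blast
    then have "y = 0" using B_pos[of y] yU U(2) by force
    then show ?thesis by (simp add: y_def)
  qed
  show ?thesis
    by (rule that[OF G(1) GU pos exp])
qed

lemma hom_expansion:
  fixes \<tau> :: "'h \<Rightarrow> 'f::field_char_0"
  assumes field: "field (factor_ring (ring_on Ainv) e)"
    and \<tau>: "\<tau> \<in> ring_hom (factor_ring (ring_on Ainv) e) ring_of_type_algebra"
    and G: "finite G" "G \<subseteq> inv.corner e"
    and x: "x = (\<Sum>g\<in>G. c g *\<^sub>Q g)"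
  shows "\<tau> x = (\<Sum>g\<in>G. of_rat (c g) * \<tau> g)"
proof -
  note hom = inv.corner_homD[OF field \<tau>]
  note sub = inv.subspace_corner[of e]
  have "\<tau> 0 = 0" using hom(1)[of 0 0] rat_vector.subspace_0[OF sub] by simp
  have "(\<Sum>g\<in>G. c g *\<^sub>Q g) \<in> inv.corner e \<and> \<tau> (\<Sum>g\<in>G. c g *\<^sub>Q g) = (\<Sum>g\<in>G. of_rat (c g) * \<tau> g)"
    using G
  proof (induction G rule: finite_induct)
    case empty
    show ?case using \<open>\<tau> 0 = 0\<close> rat_vector.subspace_0[OF sub] by simp
  next
    case (insert g G)
    then have "c g *\<^sub>Q g \<in> inv.corner e" using rat_vector.subspace_scale[OF sub] by blast
    then show ?case
      using insert hom(1) hom(4)[of g "c g"] rat_vector.subspace_add[OF sub] by simp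
  qed
  then show ?thesis using x by simp
qed

text \<open>In the orthogonal basis \<open>G\<close> the vector with coordinates \<open>\<tau> g / B g g\<close> is an eigenvector of
  multiplication by \<open>c\<close> with eigenvalue \<open>\<tau> c\<close>, because it represents \<open>\<tau>\<close> with respect to \<open>B\<close>.
  The identity below pairs it with an arbitrary vector.\<close>

lemma hom_eigenvector:
  fixes \<tau> :: "'h \<Rightarrow> 'f::field_char_0"
  assumes field: "field (factor_ring (ring_on Ainv) e)" and e: "e \<in> Ainv"
    and \<tau>: "\<tau> \<in> ring_hom (factor_ring (ring_on Ainv) e) ring_of_type_algebra"
    and G: "finite G" "G \<subseteq> inv.corner e"
    and exp: "\<And>x. x \<in> inv.corner e \<Longrightarrow> x = (\<Sum>g\<in>G. (B x g / B g g) *\<^sub>Q g)"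
    and c: "c \<in> inv.corner e"
  shows "\<tau> c * (\<Sum>g\<in>G. y g * \<tau> g / of_rat (B g g)) =
    (\<Sum>g\<in>G. \<Sum>g'\<in>G. of_rat (B (c * g) g') * (y g / of_rat (B g g)) * (\<tau> g' / of_rat (B g' g')))"
proof -
  have cg: "\<tau> c * \<tau> g = (\<Sum>g'\<in>G. of_rat (B (c * g) g') * (\<tau> g' / of_rat (B g' g')))" if g: "g \<in> G" for g
  proof -
    have "c * g \<in> inv.corner e"
      using c g G(2) inv.corner_iff[OF e inv.field_corner_idem(1)[OF field e]]
      by (metis (no_types, lifting) inv.mult_mem mult.assoc subsetD)
    then have "\<tau> (c * g) = (\<Sum>g'\<in>G. of_rat (B (c * g) g' / B g' g') * \<tau> g')"
      by (intro hom_expansion[OF field \<tau> G] exp)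
    moreover have "\<tau> (c * g) = \<tau> c * \<tau> g"
      using inv.corner_homD(2)[OF field \<tau> c] g G(2) by blast
    ultimately show ?thesis by (simp add: of_rat_divide)
  qed
  have "\<tau> c * (\<Sum>g\<in>G. y g * \<tau> g / of_rat (B g g)) = (\<Sum>g\<in>G. (y g / of_rat (B g g)) * (\<tau> c * \<tau> g))"
    by (simp add: sum_distrib_left mult_ac)
  also have "\<dots> = (\<Sum>g\<in>G. (y g / of_rat (B g g)) *
      (\<Sum>g'\<in>G. of_rat (B (c * g) g') * (\<tau> g' / of_rat (B g' g'))))"
    by (intro sum.cong) (simp_all add: cg)
  finally show ?thesis by (simp add: sum_distrib_left mult_ac)
qed

lemma corner_form_symmetric:
  assumes e: "e \<in> Ainv" and G: "c \<in> inv.corner e" "g \<in> inv.corner e" "g' \<in> inv.corner e"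
  shows "B (c * g) g' = B (c * g') g"
proof -
  have mem: "c \<in> Ainv" "g \<in> Ainv" "g' \<in> Ainv"
    using G inv.mult_mem[OF e] by blast+
  then show ?thesis using adjoint[of c g g'] by (simp add: B_sym)
qed

text \<open>If \<open>\<tau>\<close> vanished on \<open>G\<close>, the expansion of \<open>e\<close>
  would give \<open>\<tau> e = 0\<close>. This makes the weighted sum of squares, by which later
  proofs divide, strictly positive.\<close>

lemma hom_nonzero_on_basis:
  fixes \<tau> :: "'h \<Rightarrow> 'f::field_char_0"
  assumes field: "field (factor_ring (ring_on Ainv) e)" and e: "e \<in> Ainv"
    and \<tau>: "\<tau> \<in> ring_hom (factor_ring (ring_on Ainv) e) ring_of_type_algebra"
    and G: "finite G" "G \<subseteq> inv.corner e"
    and exp: "\<And>x. x \<in> inv.corner e \<Longrightarrow> x = (\<Sum>g\<in>G. (B x g / B g g) *\<^sub>Q g)"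
  shows "\<exists>g\<in>G. \<tau> g \<noteq> 0"
proof (rule ccontr)
  assume "\<not> ?thesis"
  then have "\<tau> e = 0"
    using hom_expansion[OF field \<tau> G exp] inv.field_corner_idem(2)[OF field e] by simp
  then show False using inv.corner_homD(3)[OF field \<tau>] by simp
qed

text \<open>The argument that symmetric matrices have real eigenvalues:
  \<open>hom_eigenvector\<close> with \<open>y g = cnj (\<tau> g)\<close> gives
  \<open>\<tau> c * S = Z\<close>. Here \<open>Z\<close> is a Hermitian expression in a symmetric
  rational matrix, symmetric because \<open>c\<close> is fixed by \<open>t\<close>, and
  \<open>S\<close> is a positive weighted sum of squared moduli.\<close>

theorem totally_real_corner:
  assumes field: "field (factor_ring (ring_on Ainv) e)" and e: "e \<in> Ainv"
  shows "totally_real (factor_ring (ring_on Ainv) e)"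
  unfolding totally_real_def
proof (intro ballI image_subsetI)
  fix \<tau> :: "'h \<Rightarrow> complex" and c
  assume \<tau>: "\<tau> \<in> ring_hom (factor_ring (ring_on Ainv) e) ring_of_type_algebra"
    and "c \<in> carrier (factor_ring (ring_on Ainv) e)"
  then have c: "c \<in> inv.corner e" by (simp add: factor_ring_on)
  have "inv.corner e \<subseteq> A" using inv.mult_mem[OF e] by blast
  then obtain G where G: "finite G" "G \<subseteq> inv.corner e" "\<And>g. g \<in> G \<Longrightarrow> B g g > 0"
    "\<And>x. x \<in> inv.corner e \<Longrightarrow> x = (\<Sum>g\<in>G. (B x g / B g g) *\<^sub>Q g)"
    using orthogonal_expansion[OF inv.subspace_corner] by blast
  have cnj_rat: "cnj (of_rat q) = of_rat q" for q by (cases q) (simp add: of_rat_rat)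
  have Re_rat: "of_rat q = complex_of_real (of_rat q)" for q by (cases q) (simp add: of_rat_rat)
  define S where "S = (\<Sum>g\<in>G. cnj (\<tau> g) * \<tau> g / of_rat (B g g))"
  define Z where "Z = (\<Sum>g\<in>G. \<Sum>g'\<in>G. of_rat (B (c * g) g') * (cnj (\<tau> g) / of_rat (B g g)) * (\<tau> g' / of_rat (B g' g')))"
  have "\<tau> c * S = Z"
    unfolding S_def Z_def by (rule hom_eigenvector[OF field e \<tau> G(1,2,4) c])
  moreover have "cnj Z = Z"
  proof -
    have "cnj Z = (\<Sum>g\<in>G. \<Sum>g'\<in>G. of_rat (B (c * g) g') * (\<tau> g / of_rat (B g g)) * (cnj (\<tau> g') / of_rat (B g' g')))"
      by (simp add: Z_def cnj_rat)
    also have "\<dots> = (\<Sum>g'\<in>G. \<Sum>g\<in>G. of_rat (B (c * g) g') * (\<tau> g / of_rat (B g g)) * (cnj (\<tau> g') / of_rat (B g' g')))"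
      by (rule sum.swap)
    also have "\<dots> = Z"
      unfolding Z_def
    proof (intro sum.cong refl)
      fix g g' assume "g \<in> G" "g' \<in> G"
      then have "B (c * g') g = B (c * g) g'"
        using corner_form_symmetric[OF e c] G(2) by blast
      then show "of_rat (B (c * g') g) * (\<tau> g' / of_rat (B g' g')) * (cnj (\<tau> g) / of_rat (B g g)) =
        of_rat (B (c * g) g') * (cnj (\<tau> g) / of_rat (B g g)) * (\<tau> g' / of_rat (B g' g'))"
        by (simp add: mult_ac)
    qed
    finally show ?thesis .
  qed
  moreover define s where "s = (\<Sum>g\<in>G. (cmod (\<tau> g))\<^sup>2 / of_rat (B g g))"
  have S: "S = of_real s"
    unfolding S_def s_def of_real_sum of_real_divide complex_norm_square by (simp add: Re_rat mult.commute)
  have "s > 0"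
  proof -
    obtain g where "g \<in> G" "\<tau> g \<noteq> 0" using hom_nonzero_on_basis[OF field e \<tau> G(1,2,4)] by blast
    then show ?thesis unfolding s_def using G(1)
      by (intro sum_pos2[of _ g]) (auto simp: G(3) less_imp_le)
  qed
  then have "S \<noteq> 0" "S \<in> \<real>" by (auto simp: S)
  ultimately have "\<tau> c = Z / S" "Z \<in> \<real>" by (simp_all add: field_simps Reals_cnj_iff)
  then show "\<tau> c \<in> \<real>" using \<open>S \<in> \<real>\<close> by simp
qed

text \<open>Skewness gives \<open>B (\<alpha> * \<alpha> * g) g' = - B (\<alpha> * g') (\<alpha> *
  g)\<close>, a negated Gram matrix. Evaluated on the real vector \<open>z\<close> it is a negated
  sum of squares with positive weights, so the eigenvalue
  \<open>\<sigma> (\<alpha> * \<alpha>)\<close> is at most zero; it is nonzero because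
  \<open>\<alpha> * \<alpha>\<close> is invertible in the factor.\<close>

lemma hom_skew_square_neg:
  fixes \<sigma> :: "'h \<Rightarrow> real"
  assumes field: "field (factor_ring (ring_on Ainv) e)" and e: "e \<in> Ainv"
    and \<sigma>: "\<sigma> \<in> ring_hom (factor_ring (ring_on Ainv) e) ring_of_type_algebra"
    and \<alpha>: "\<alpha> \<in> A" "e * \<alpha> = \<alpha>" "t \<alpha> = - \<alpha>" "\<alpha> \<noteq> 0"
  shows "\<sigma> (\<alpha> * \<alpha>) < 0"
proof -
  note c = inv.corner_iff[OF e inv.field_corner_idem(1)[OF field e]]
  have d: "\<alpha> * \<alpha> \<in> inv.corner e"
    unfolding c using \<alpha> by (simp add: mult_mem t_mult flip: mult.assoc)
  have "inv.corner e \<subseteq> A" using inv.mult_mem[OF e] by blast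
  then obtain G where G: "finite G" "G \<subseteq> inv.corner e" "\<And>g. g \<in> G \<Longrightarrow> B g g > 0"
    "\<And>x. x \<in> inv.corner e \<Longrightarrow> x = (\<Sum>g\<in>G. (B x g / B g g) *\<^sub>Q g)"
    using orthogonal_expansion[OF inv.subspace_corner] by blast
  \<comment> \<open>The products \<open>\<alpha> * g\<close> are skew, so \<open>G\<close> cannot
    expand them; a second orthogonal basis, of all of \<open>A\<close>, writes their Gram matrix as
    a sum of squares.\<close>
  obtain L where L: "finite L" "L \<subseteq> A" "\<And>k. k \<in> L \<Longrightarrow> B k k > 0"
    "\<And>x. x \<in> A \<Longrightarrow> x = (\<Sum>k\<in>L. (B x k / B k k) *\<^sub>Q k)"
    using orthogonal_expansion[OF subspace subset_refl] by metis
  define S where "S = (\<Sum>g\<in>G. \<sigma> g * \<sigma> g / of_rat (B g g))"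
  define z where "z g = \<sigma> g / of_rat (B g g)" for g
  have GA: "g \<in> A" if "g \<in> G" for g using that G(2) c by auto
  have B\<alpha>: "B (\<alpha> * \<alpha> * g) g' = - (\<Sum>k\<in>L. B (\<alpha> * g) k * B (\<alpha> * g') k / B k k)"
    if g: "g \<in> G" "g' \<in> G" for g g'
  proof -
    have m: "\<alpha> * g \<in> A" "\<alpha> * g' \<in> A" using \<alpha> GA g mult_mem by auto
    have "B (\<alpha> * \<alpha> * g) g' = - B (\<alpha> * g') (\<alpha> * g)"
      using adjoint[of \<alpha> "\<alpha> * g" g'] m \<alpha> GA g
      by (simp add: mult.assoc B_sym[of _ "- _"] B_minus)
    also have "B (\<alpha> * g') (\<alpha> * g) = (\<Sum>k\<in>L. B (\<alpha> * g) k * B (\<alpha> * g') k / B k k)"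
    proof -
      have "B (\<alpha> * g') (\<alpha> * g) = B (\<Sum>k\<in>L. (B (\<alpha> * g') k / B k k) *\<^sub>Q k) (\<alpha> * g)"
        using L(4)[OF m(2)] by simp
      also have "\<dots> = (\<Sum>k\<in>L. B (\<alpha> * g') k / B k k * B k (\<alpha> * g))" by (simp only: B_sum B_scale)
      finally show ?thesis by (simp add: B_sym[of _ "\<alpha> * g"] mult.commute)
    qed
    finally show ?thesis .
  qed
  have "\<sigma> (\<alpha> * \<alpha>) * S = (\<Sum>g\<in>G. \<Sum>g'\<in>G. of_rat (B (\<alpha> * \<alpha> * g) g') * z g * z g')"
    unfolding S_def z_def by (rule hom_eigenvector[OF field e \<sigma> G(1,2,4) d])
  also have "\<dots> = - (\<Sum>g\<in>G. \<Sum>g'\<in>G. \<Sum>k\<in>L.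
      (of_rat (B (\<alpha> * g) k) * z g) * (of_rat (B (\<alpha> * g') k) * z g') / of_rat (B k k))"
    unfolding sum_negf[symmetric]
  proof (intro sum.cong refl)
    fix g g' assume "g \<in> G" "g' \<in> G"
    then show "of_rat (B (\<alpha> * \<alpha> * g) g') * z g * z g' = (\<Sum>k\<in>L.
        - ((of_rat (B (\<alpha> * g) k) * z g) * (of_rat (B (\<alpha> * g') k) * z g') / of_rat (B k k)))"
      unfolding B\<alpha>[OF \<open>g \<in> G\<close> \<open>g' \<in> G\<close>] of_rat_minus of_rat_sum of_rat_mult of_rat_divide
      by (simp add: sum_negf sum_distrib_left sum_distrib_right mult_ac)
  qed
  \<comment> \<open>With \<open>k\<close> outermost, the double sum over \<open>g\<close> and
    \<open>g'\<close> becomes the square of a single sum.\<close>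
  also have "\<dots> = - (\<Sum>k\<in>L. \<Sum>g\<in>G. \<Sum>g'\<in>G.
      (of_rat (B (\<alpha> * g) k) * z g) * (of_rat (B (\<alpha> * g') k) * z g') / of_rat (B k k))"
    by (subst (2) sum.swap, subst sum.swap) simp
  also have "\<dots> = - (\<Sum>k\<in>L. (\<Sum>g\<in>G. of_rat (B (\<alpha> * g) k) * z g)\<^sup>2 / of_rat (B k k))"
    by (simp add: power2_eq_square sum_product sum_divide_distrib)
  also have "\<dots> \<le> 0"
    by (auto intro!: sum_nonneg divide_nonneg_nonneg simp: L(3) less_imp_le)
  finally have "\<sigma> (\<alpha> * \<alpha>) * S \<le> 0" .
  moreover have "S > 0"
  proof -
    obtain g where "g \<in> G" "\<sigma> g \<noteq> 0" using hom_nonzero_on_basis[OF field e \<sigma> G(1,2,4)] by blast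
    then show ?thesis unfolding S_def using G(1)
      by (intro sum_pos2[of _ g]) (auto simp: G(3) less_imp_le simp flip: power2_eq_square)
  qed
  moreover have "\<sigma> (\<alpha> * \<alpha>) \<noteq> 0"
  proof -
    have "\<alpha> * \<alpha> \<noteq> 0" using reduced \<alpha> by blast
    then obtain d' where d': "d' \<in> inv.corner e" "\<alpha> * \<alpha> * d' = e" using inv.corner_inverse[OF field d] by blast
    then have "\<sigma> (\<alpha> * \<alpha>) * \<sigma> d' = 1"
      using inv.corner_homD(2)[OF field \<sigma> d d'(1)] inv.corner_homD(3)[OF field \<sigma>] by simp
    then show ?thesis by auto
  qed
  ultimately show ?thesis by (simp add: mult_le_0_iff)
qed

section \<open>A factor of the invariant part and its quadratic extension\<close>

lemma field_corner_of_inv: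
  assumes field: "field (factor_ring (ring_on Ainv) e)" and e: "e \<in> Ainv"
  shows "field (factor_ring (ring_on A) e)"
proof (rule field_cornerI)
  note idem = inv.field_corner_idem[OF field e]
  show "e \<in> A" "e * e = e" "e \<noteq> 0" using e idem by auto
  note cA = corner_iff[OF this(1,2)] and cI = inv.corner_iff[OF e this(2)]
  fix x assume "x \<in> corner e" "x \<noteq> 0"
  then have x: "x \<in> A" "e * x = x" "x * t x \<noteq> 0" using norm_eq_0_iff cA by auto
  have "x * t x \<in> inv.corner e"
    unfolding cI using x mult_comm[of x "t x"] mult.assoc[of e x "t x"]
    by (simp add: mult_mem t_mem t_mult t_t)
  then obtain y where y: "y \<in> inv.corner e" "x * t x * y = e" using inv.corner_inverse[OF field] x(3) by blast
  have "e * (t x * y) = t x * y"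
    using y(1) x t_mult[of e x] e unfolding cI by (simp flip: mult.assoc)
  then have "t x * y \<in> corner e" using y(1) x(1) unfolding cI cA by (simp add: mult_mem t_mem)
  moreover have "x * (t x * y) = e" using y(2) by (simp add: mult.assoc)
  ultimately show "\<exists>y\<in>corner e. x * y = e" by blast
qed

lemma exists_skew:
  assumes e: "e \<in> Ainv" "e * e = e" and ne: "inv.corner e \<noteq> corner e"
  shows "\<exists>\<alpha>\<in>A. e * \<alpha> = \<alpha> \<and> t \<alpha> = - \<alpha> \<and> \<alpha> \<noteq> 0"
proof -
  obtain x where "x \<in> corner e" "x \<notin> inv.corner e" using ne by blast
  then have x: "x \<in> A" "e * x = x" "t x \<noteq> x"
    using corner_iff[of e x] inv.corner_iff[OF e, of x] e by auto
  moreover have "e * t x = t x" using x t_mult[of e x] e by simp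
  ultimately show ?thesis
    by (intro bexI[of _ "x - t x"]) (simp_all add: right_diff_distrib t_diff t_t diff_mem t_mem)
qed

text \<open>Halving \<open>x + t x\<close> and \<open>x - t x\<close> splits \<open>x\<close> into a
  fixed part and a skew part \<open>w\<close>. Products of two skew elements are fixed, so with
  \<open>d'\<close> the inverse of \<open>\<alpha> * \<alpha>\<close> the element
  \<open>w * \<alpha> * d'\<close> is fixed and its product with \<open>\<alpha>\<close> is
  \<open>w\<close>. For independence, applying \<open>t\<close> changes the sign of
  \<open>v * \<alpha>\<close> alone, whence \<open>u + u = 0\<close>.\<close>

lemma corner_skew_decomposition:
  assumes field: "field (factor_ring (ring_on Ainv) e)" and e: "e \<in> Ainv"
    and \<alpha>: "\<alpha> \<in> A" "e * \<alpha> = \<alpha>" "t \<alpha> = - \<alpha>" "\<alpha> \<noteq> 0"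
  shows "corner e = {u + v * \<alpha> |u v. u \<in> inv.corner e \<and> v \<in> inv.corner e}"
    and "u \<in> inv.corner e \<Longrightarrow> v \<in> inv.corner e \<Longrightarrow> u + v * \<alpha> = 0 \<Longrightarrow> u = 0 \<and> v = 0"
proof -
  note idem = inv.field_corner_idem[OF field e]
  note cI = inv.corner_iff[OF e idem(1)]
  have cA: "x \<in> corner e \<longleftrightarrow> x \<in> A \<and> e * x = x" for x using corner_iff[of e x] e idem by simp
  have d: "\<alpha> * \<alpha> \<in> inv.corner e"
    unfolding cI using \<alpha> by (simp add: mult_mem t_mult flip: mult.assoc)
  have "\<alpha> * \<alpha> \<noteq> 0" using reduced \<alpha> by blast
  then obtain d' where d': "d' \<in> inv.corner e" "\<alpha> * \<alpha> * d' = e" using inv.corner_inverse[OF field d] by blast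
  have comm\<alpha>: "d' * \<alpha> = \<alpha> * d'" using d' \<alpha> mult_comm unfolding cI by simp
  show "corner e = {u + v * \<alpha> |u v. u \<in> inv.corner e \<and> v \<in> inv.corner e}"
  proof (intro equalityI subsetI)
    fix x assume "x \<in> corner e"
    then have x: "x \<in> A" "e * x = x" unfolding cA by auto
    have tx: "t x \<in> A" "e * t x = t x" using x t_mem t_mult[of e x] e by auto
    define u where "u = (1/2) *\<^sub>Q (x + t x)"
    define w where "w = (1/2) *\<^sub>Q (x - t x)"
    have u: "u \<in> inv.corner e" unfolding cI u_def
      using x tx by (simp add: scale_mem add_mem t_scale t_add t_t add.commute mult_scaleQ_right distrib_left)
    have w: "w \<in> A" "e * w = w" "t w = - w"
      using x tx by (simp_all add: w_def scale_mem diff_mem t_scale t_diff t_t mult_scaleQ_right right_diff_distrib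
          flip: rat_vector.scale_minus_right)
    have v: "w * \<alpha> * d' \<in> inv.corner e"
      using w \<alpha> d'(1) unfolding cI by (simp add: mult_mem t_mult flip: mult.assoc)
    have "w * \<alpha> * d' * \<alpha> = w * (\<alpha> * \<alpha> * d')" using comm\<alpha> by (simp add: mult.assoc)
    also have "\<dots> = w" using d'(2) w mult_comm[of w e] e by simp
    finally have w_eq: "w * \<alpha> * d' * \<alpha> = w" .
    have "u + w = (1/2) *\<^sub>Q (x + x)" by (simp add: u_def w_def flip: scaleQ_add_right)
    also have "\<dots> = x" by (simp add: scaleQ_add_right scaleQ_one flip: scaleQ_add_left)
    finally have "x = u + (w * \<alpha> * d') * \<alpha>" by (simp add: w_eq)
    then show "x \<in> {u + v * \<alpha> |u v. u \<in> inv.corner e \<and> v \<in> inv.corner e}" using u v by blast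
  next
    fix x assume "x \<in> {u + v * \<alpha> |u v. u \<in> inv.corner e \<and> v \<in> inv.corner e}"
    then obtain u v where "x = u + v * \<alpha>" "u \<in> inv.corner e" "v \<in> inv.corner e" by blast
    then show "x \<in> corner e" using \<alpha> unfolding cI cA
      by (simp add: add_mem mult_mem distrib_left flip: mult.assoc)
  qed
  show "u = 0 \<and> v = 0" if u: "u \<in> inv.corner e" and v: "v \<in> inv.corner e" and eq: "u + v * \<alpha> = 0"
  proof -
    have "t (u + v * \<alpha>) = u - v * \<alpha>" using u v \<alpha> unfolding cI by (simp add: t_add t_mult)
    then have "u = v * \<alpha>" using eq by (simp add: t_zero)
    then have "u + u = 0" using eq by simp
    then have "(1 + 1) *\<^sub>Q u = 0" by (simp only: scaleQ_add_left scaleQ_one)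
    then have "u = 0" by simp
    then have "v * \<alpha> = 0" using \<open>u = v * \<alpha>\<close> by simp
    then have "v * (\<alpha> * \<alpha> * d') = 0" by (metis mult.assoc mult_zero_left)
    then have "v = 0" using d'(2) v mult_comm[of v e] e unfolding cI by simp
    then show ?thesis using \<open>u = 0\<close> by simp
  qed
qed

end

section \<open>Base change of an imaginary quadratic extension\<close>

definition frag_eval :: "('c \<Rightarrow> complex) \<Rightarrow> ('c \<Rightarrow>\<^sub>0 int) \<Rightarrow> complex" where
  "frag_eval g x = (\<Sum>k\<in>Poly_Mapping.keys x. of_int (Poly_Mapping.lookup x k) * g k)"

lemma frag_eval_of: "frag_eval g (frag_of k) = g k"
  by (simp add: frag_eval_def)

lemma frag_eval_add: "frag_eval g (x + y) = frag_eval g x + frag_eval g y"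
proof -
  have sup: "frag_eval g z = (\<Sum>k\<in>S. of_int (Poly_Mapping.lookup z k) * g k)"
    if "finite S" "Poly_Mapping.keys z \<subseteq> S" for z S
    unfolding frag_eval_def using that by (intro sum.mono_neutral_left) (auto simp: in_keys_iff)
  let ?S = "Poly_Mapping.keys x \<union> Poly_Mapping.keys y"
  have "finite ?S" "Poly_Mapping.keys (x + y) \<subseteq> ?S" by (simp_all add: Poly_Mapping.keys_add)
  then show ?thesis
    by (simp add: sup[of ?S] lookup_add distrib_right sum.distrib)
qed

lemma frag_eval_0: "frag_eval g 0 = 0"
  by (simp add: frag_eval_def)

lemma frag_eval_diff: "frag_eval g (x - y) = frag_eval g x - frag_eval g y"
  using frag_eval_add[of g "x - y" y] by simp

section \<open>Multiplication of formal sums of pairs\<close>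

definition pair_mult :: "('a::times \<times> 'b::times \<Rightarrow>\<^sub>0 int) \<Rightarrow> ('a \<times> 'b \<Rightarrow>\<^sub>0 int) \<Rightarrow> ('a \<times> 'b \<Rightarrow>\<^sub>0 int)" where
  "pair_mult x y = frag_extend (\<lambda>(a, b). frag_extend (\<lambda>(a', b'). frag_of (a * a', b * b')) y) x"

lemma pair_mult_of: "pair_mult (frag_of (a, b)) (frag_of (a', b')) = frag_of (a * a', b * b')"
  by (simp add: pair_mult_def)

lemma pair_mult_zero: "pair_mult 0 y = 0" "pair_mult x 0 = 0"
proof -
  show "pair_mult 0 y = 0" by (simp add: pair_mult_def)
  show "pair_mult x 0 = 0"
    by (induction x rule: frag_tensor_induct) (simp_all add: pair_mult_def frag_extend_diff)
qed

lemma pair_mult_diff_left: "pair_mult (x - x') y = pair_mult x y - pair_mult x' y"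
  by (simp add: pair_mult_def frag_extend_diff)

lemma pair_mult_diff_right: "pair_mult x (y - y') = pair_mult x y - pair_mult x y'"
  by (induction x rule: frag_tensor_induct)
    (simp_all add: pair_mult_zero pair_mult_diff_left, simp add: pair_mult_def frag_extend_diff)

lemmas pair_mult_diff = pair_mult_diff_left pair_mult_diff_right

lemma pair_mult_add:
  "pair_mult (x + x') y = pair_mult x y + pair_mult x' y"
  "pair_mult x (y + y') = pair_mult x y + pair_mult x y'"
  using pair_mult_diff(1)[of "x + x'" x' y] pair_mult_diff(2)[of x "y + y'" y']
  by (simp_all add: algebra_simps)

lemma pair_mult_assoc: "pair_mult (pair_mult x y) z = pair_mult x (pair_mult y z)"
  for x y z :: "'a::semigroup_mult \<times> 'b::semigroup_mult \<Rightarrow>\<^sub>0 int"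
proof -
  have 1: "pair_mult (pair_mult (frag_of (a, b)) (frag_of (a', b'))) z =
      pair_mult (frag_of (a, b)) (pair_mult (frag_of (a', b')) z)" for a a' :: 'a and b b' :: 'b
    by (induction z rule: frag_tensor_induct) (simp_all add: pair_mult_zero pair_mult_diff pair_mult_of mult.assoc)
  have 2: "pair_mult (pair_mult (frag_of (a, b)) y) z =
      pair_mult (frag_of (a, b)) (pair_mult y z)" for a :: 'a and b :: 'b
    by (induction y rule: frag_tensor_induct) (simp_all add: pair_mult_zero pair_mult_diff 1)
  show ?thesis
    by (induction x rule: frag_tensor_induct) (simp_all add: pair_mult_zero pair_mult_diff 2)
qed

lemma pair_ring_eq:
  "pair_ring A eA B eB = \<lparr>carrier = {x. Poly_Mapping.keys x \<subseteq> A \<times> B}, monoid.mult = pair_mult,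
    one = frag_of (eA, eB), ring.zero = 0, add = (+)\<rparr>"
  unfolding pair_ring_def pair_mult_def ..

lemma keys_frag_induct [consumes 1, case_names zero of diff]:
  assumes "Poly_Mapping.keys x \<subseteq> A \<times> B" and "P 0"
    and "\<And>a b. a \<in> A \<Longrightarrow> b \<in> B \<Longrightarrow> P (frag_of (a, b))" and "\<And>x y. P x \<Longrightarrow> P y \<Longrightarrow> P (x - y)"
  shows "P x"
  by (rule frag_induction[OF assms(1)]) (use assms(2-) in auto)

lemma keys_diff_subset:
  "Poly_Mapping.keys x \<subseteq> S \<Longrightarrow> Poly_Mapping.keys y \<subseteq> S \<Longrightarrow> Poly_Mapping.keys (x - y :: 'c \<Rightarrow>\<^sub>0 int) \<subseteq> S"
  using keys_diff[of x y] by blast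

lemma ring_pair_ring:
  fixes A :: "'a::ring set" and B :: "'b::ring set"
  assumes A: "eA \<in> A" "\<And>x y. x \<in> A \<Longrightarrow> y \<in> A \<Longrightarrow> x * y \<in> A" "\<And>x. x \<in> A \<Longrightarrow> eA * x = x" "\<And>x. x \<in> A \<Longrightarrow> x * eA = x"
    and B: "eB \<in> B" "\<And>x y. x \<in> B \<Longrightarrow> y \<in> B \<Longrightarrow> x * y \<in> B" "\<And>x. x \<in> B \<Longrightarrow> eB * x = x" "\<And>x. x \<in> B \<Longrightarrow> x * eB = x"
  shows "ring (pair_ring A eA B eB)"
proof (rule ringI)
  show "abelian_group (pair_ring A eA B eB)"
  proof (rule abelian_groupI)
    fix x assume "x \<in> carrier (pair_ring A eA B eB)"
    then show "\<exists>y\<in>carrier (pair_ring A eA B eB). y \<oplus>\<^bsub>pair_ring A eA B eB\<^esub> x = \<zero>\<^bsub>pair_ring A eA B eB\<^esub>"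
      by (intro bexI[of _ "- x"]) (simp_all add: pair_ring_eq)
  next
    fix x y assume "x \<in> carrier (pair_ring A eA B eB)" "y \<in> carrier (pair_ring A eA B eB)"
    then show "x \<oplus>\<^bsub>pair_ring A eA B eB\<^esub> y \<in> carrier (pair_ring A eA B eB)"
      using Poly_Mapping.keys_add[of x y] by (auto simp: pair_ring_eq)
  qed (simp_all add: pair_ring_eq algebra_simps)
  show "monoid (pair_ring A eA B eB)"
  proof (rule monoidI)
    fix x y assume x: "x \<in> carrier (pair_ring A eA B eB)" and y: "y \<in> carrier (pair_ring A eA B eB)"
    have y': "Poly_Mapping.keys y \<subseteq> A \<times> B" using y by (simp add: pair_ring_eq)
    have 1: "Poly_Mapping.keys (pair_mult (frag_of (a, b)) y) \<subseteq> A \<times> B" if "a \<in> A" "b \<in> B" for a b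
      using y' by (induction y rule: keys_frag_induct)
        (use that A(2) B(2) in \<open>simp_all add: pair_mult_zero pair_mult_diff pair_mult_of keys_diff_subset\<close>)
    have "Poly_Mapping.keys x \<subseteq> A \<times> B" using x by (simp add: pair_ring_eq)
    then have "Poly_Mapping.keys (pair_mult x y) \<subseteq> A \<times> B"
      by (induction x rule: keys_frag_induct)
        (simp_all add: pair_mult_zero pair_mult_diff 1 keys_diff_subset)
    then show "x \<otimes>\<^bsub>pair_ring A eA B eB\<^esub> y \<in> carrier (pair_ring A eA B eB)" by (simp add: pair_ring_eq)
  next
    fix x assume "x \<in> carrier (pair_ring A eA B eB)"
    then have x: "Poly_Mapping.keys x \<subseteq> A \<times> B" by (simp add: pair_ring_eq)
    then have "pair_mult (frag_of (eA, eB)) x = x"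
      by (induction x rule: keys_frag_induct) (simp_all add: pair_mult_zero pair_mult_diff pair_mult_of A B)
    then show "\<one>\<^bsub>pair_ring A eA B eB\<^esub> \<otimes>\<^bsub>pair_ring A eA B eB\<^esub> x = x" by (simp add: pair_ring_eq)
    from x have "pair_mult x (frag_of (eA, eB)) = x"
      by (induction x rule: keys_frag_induct) (simp_all add: pair_mult_zero pair_mult_diff pair_mult_of A B)
    then show "x \<otimes>\<^bsub>pair_ring A eA B eB\<^esub> \<one>\<^bsub>pair_ring A eA B eB\<^esub> = x" by (simp add: pair_ring_eq)
  qed (simp_all add: pair_ring_eq pair_mult_assoc A B)
qed (simp_all add: pair_ring_eq pair_mult_add)

text \<open>The involution and the form are forgotten here. \<open>F\<close> stands for K_i^+ and
  \<open>E\<close> for K_i, and positivity survives only as the sign of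
  \<open>\<sigma> (\<alpha> * \<alpha>)\<close>.\<close>

locale imaginary_quadratic_extension =
  fixes F E :: "'a::ring set" and e \<alpha> :: 'a and \<sigma> :: "'a \<Rightarrow> real"
  assumes F_zero: "0 \<in> F"
    and F_add: "x \<in> F \<Longrightarrow> y \<in> F \<Longrightarrow> x + y \<in> F"
    and F_mult: "x \<in> F \<Longrightarrow> y \<in> F \<Longrightarrow> x * y \<in> F"
    and F_one: "e \<in> F"
    and E_eq: "E = {u + v * \<alpha> |u v. u \<in> F \<and> v \<in> F}"
    and E_one: "x \<in> E \<Longrightarrow> e * x = x"
    and E_comm: "x \<in> E \<Longrightarrow> y \<in> E \<Longrightarrow> x * y = y * x"
    and independent: "u \<in> F \<Longrightarrow> v \<in> F \<Longrightarrow> u' \<in> F \<Longrightarrow> v' \<in> F \<Longrightarrow> u + v * \<alpha> = u' + v' * \<alpha> \<Longrightarrow> u = u' \<and> v = v'"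
    and unit_alpha: "e * \<alpha> = \<alpha>"
    and \<alpha>_square: "\<alpha> * \<alpha> \<in> F"
    and \<sigma>_add: "x \<in> F \<Longrightarrow> y \<in> F \<Longrightarrow> \<sigma> (x + y) = \<sigma> x + \<sigma> y"
    and \<sigma>_mult: "x \<in> F \<Longrightarrow> y \<in> F \<Longrightarrow> \<sigma> (x * y) = \<sigma> x * \<sigma> y"
    and \<sigma>_one: "\<sigma> e = 1"
    and \<sigma>_\<alpha>: "\<sigma> (\<alpha> * \<alpha>) < 0"
begin

lemma E_mem: "u \<in> F \<Longrightarrow> v \<in> F \<Longrightarrow> u + v * \<alpha> \<in> E"
  unfolding E_eq by blast

lemma F_E: "u \<in> F \<Longrightarrow> u \<in> E"
  using E_mem[of u 0] F_zero by simp

lemma \<alpha>_E: "\<alpha> \<in> E"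
  using E_mem[OF F_zero F_one] unit_alpha by simp

lemma mult_formula:
  assumes "u \<in> F" "v \<in> F" "u' \<in> F" "v' \<in> F"
  shows "(u + v * \<alpha>) * (u' + v' * \<alpha>) = (u * u' + v * v' * (\<alpha> * \<alpha>)) + (u * v' + v * u') * \<alpha>"
proof -
  have c: "\<alpha> * u' = u' * \<alpha>" "\<alpha> * v' = v' * \<alpha>" using E_comm \<alpha>_E F_E assms by auto
  have "v * \<alpha> * u' = v * u' * \<alpha>" "v * \<alpha> * (v' * \<alpha>) = v * v' * (\<alpha> * \<alpha>)"
    using c by (metis mult.assoc)+
  then show ?thesis by (simp add: distrib_left distrib_right mult.assoc add_ac)
qed

lemma E_mult:
  assumes "x \<in> E" "y \<in> E"
  shows "x * y \<in> E"
proof -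
  obtain u v u' v' where uv: "u \<in> F" "v \<in> F" "u' \<in> F" "v' \<in> F" "x = u + v * \<alpha>" "y = u' + v' * \<alpha>"
    using assms unfolding E_eq by blast
  show ?thesis
    unfolding uv(5,6) mult_formula[OF uv(1-4)] using uv(1-4) \<alpha>_square by (simp add: E_mem F_add F_mult)
qed

lemma E_add:
  assumes "x \<in> E" "y \<in> E"
  shows "x + y \<in> E"
proof -
  obtain u v u' v' where uv: "u \<in> F" "v \<in> F" "u' \<in> F" "v' \<in> F" "x = u + v * \<alpha>" "y = u' + v' * \<alpha>"
    using assms unfolding E_eq by blast
  have "(u + u') + (v + v') * \<alpha> \<in> E" using uv by (intro E_mem F_add)
  then show ?thesis by (simp add: uv distrib_right add_ac)
qed

definition re where "re x = (SOME u. u \<in> F \<and> (\<exists>v\<in>F. x = u + v * \<alpha>))"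
definition im where "im x = (SOME v. v \<in> F \<and> (\<exists>u\<in>F. x = u + v * \<alpha>))"

lemma re_im: assumes "u \<in> F" "v \<in> F" shows "re (u + v * \<alpha>) = u" "im (u + v * \<alpha>) = v"
  unfolding re_def im_def by (rule some_equality; use assms independent in blast)+

text \<open>The extension of \<open>\<sigma>\<close> to \<open>E\<close> that sends
  \<open>\<alpha>\<close> to the square root of the negative number
  \<open>\<sigma> (\<alpha> * \<alpha>)\<close> on the positive imaginary axis.\<close>

definition emb :: "'a \<Rightarrow> complex" where
  "emb x = Complex (\<sigma> (re x)) (\<sigma> (im x) * sqrt (- \<sigma> (\<alpha> * \<alpha>)))"

lemma emb_formula:
  assumes "u \<in> F" "v \<in> F"
  shows "emb (u + v * \<alpha>) = Complex (\<sigma> u) (\<sigma> v * sqrt (- \<sigma> (\<alpha> * \<alpha>)))"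
  by (simp add: emb_def re_im assms)

lemma E_cases:
  assumes "x \<in> E"
  obtains u v where "u \<in> F" "v \<in> F" "x = u + v * \<alpha>"
  using assms unfolding E_eq by blast

lemma emb_add:
  assumes "x \<in> E" "y \<in> E"
  shows "emb (x + y) = emb x + emb y"
proof -
  obtain u v where x: "u \<in> F" "v \<in> F" "x = u + v * \<alpha>" using assms(1) by (rule E_cases)
  obtain u' v' where y: "u' \<in> F" "v' \<in> F" "y = u' + v' * \<alpha>" using assms(2) by (rule E_cases)
  have "x + y = (u + u') + (v + v') * \<alpha>" by (simp add: x y distrib_right)
  then have "emb (x + y) = Complex (\<sigma> (u + u')) (\<sigma> (v + v') * sqrt (- \<sigma> (\<alpha> * \<alpha>)))"
    using emb_formula[OF F_add[OF x(1) y(1)] F_add[OF x(2) y(2)]] by simp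
  then show ?thesis
    by (simp add: x y emb_formula \<sigma>_add complex_eq_iff distrib_right)
qed

lemma emb_mult:
  assumes "x \<in> E" "y \<in> E"
  shows "emb (x * y) = emb x * emb y"
proof -
  let ?d = "\<alpha> * \<alpha>"
  obtain u v where x: "u \<in> F" "v \<in> F" "x = u + v * \<alpha>" using assms(1) by (rule E_cases)
  obtain u' v' where y: "u' \<in> F" "v' \<in> F" "y = u' + v' * \<alpha>" using assms(2) by (rule E_cases)
  have mem: "u * u' \<in> F" "v * v' \<in> F" "v * v' * ?d \<in> F" "u * v' \<in> F" "v * u' \<in> F"
    using x y F_mult \<alpha>_square by auto
  have "emb (x * y) = Complex (\<sigma> (u * u' + v * v' * ?d)) (\<sigma> (u * v' + v * u') * sqrt (- \<sigma> ?d))"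
    using mult_formula[OF x(1,2) y(1,2)] mem by (simp add: x(3) y(3) emb_formula F_add)
  also have "\<dots> = Complex (\<sigma> u * \<sigma> u' + \<sigma> v * \<sigma> v' * \<sigma> ?d)
      ((\<sigma> u * \<sigma> v' + \<sigma> v * \<sigma> u') * sqrt (- \<sigma> ?d))"
    using mem x y \<alpha>_square by (simp add: \<sigma>_add \<sigma>_mult)
  also have "\<dots> = emb x * emb y"
  proof -
    have "sqrt (- \<sigma> ?d) * sqrt (- \<sigma> ?d) = - \<sigma> ?d" using \<sigma>_\<alpha> by simp
    then have "\<sigma> v * sqrt (- \<sigma> ?d) * (\<sigma> v' * sqrt (- \<sigma> ?d)) = - (\<sigma> v * \<sigma> v' * \<sigma> ?d)"
      by (metis (no_types, opaque_lifting) mult.assoc mult.left_commute mult_minus_right)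
    then show ?thesis using x y
      by (simp add: emb_formula complex_eq_iff algebra_simps)
  qed
  finally show ?thesis .
qed

lemma emb_F: "u \<in> F \<Longrightarrow> emb u = of_real (\<sigma> u)"
proof -
  assume "u \<in> F"
  moreover have "\<sigma> 0 = 0" using \<sigma>_add[OF F_zero F_zero] by simp
  ultimately show ?thesis using emb_formula[of u 0] F_zero by (simp add: complex_eq_iff)
qed

lemma emb_one: "emb e = 1"
  by (simp add: emb_F F_one \<sigma>_one)

lemma emb_\<alpha>: "emb \<alpha> = Complex 0 (sqrt (- \<sigma> (\<alpha> * \<alpha>)))"
proof -
  have "\<sigma> 0 = 0" using \<sigma>_add[OF F_zero F_zero] by simp
  then show ?thesis using emb_formula[OF F_zero F_one] by (simp add: unit_alpha \<sigma>_one)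
qed

abbreviation N where "N \<equiv> tensor_null F (*) (\<lambda>c r. \<sigma> c * r) E (UNIV :: real set)"
abbreviation R where "R \<equiv> pair_ring E e (UNIV :: real set) 1"
abbreviation eval where "eval \<equiv> frag_eval (\<lambda>(a, r). emb a * of_real r)"

lemma N_carrier: "x \<in> N \<Longrightarrow> x \<in> carrier R"
proof (induction rule: tensor_null.induct)
  case (diff x y)
  then show ?case by (simp add: pair_ring_eq keys_diff_subset)
next
  case (add_left a a' b)
  then have "a + a' \<in> E"
    using E_add by blast
  with add_left show ?case by (simp add: pair_ring_eq keys_diff_subset)
next
  case (add_right a b b')
  then show ?case by (simp add: pair_ring_eq keys_diff_subset)
next
  case (balanced f a b)
  then have "f * a \<in> E" using E_mult F_E by blast
  with balanced show ?case by (simp add: pair_ring_eq keys_diff_subset)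
qed (simp add: pair_ring_eq)

lemma N_eval: "x \<in> N \<Longrightarrow> eval x = 0"
proof (induction rule: tensor_null.induct)
  case (balanced f a b)
  then show ?case by (simp add: frag_eval_diff frag_eval_of emb_mult F_E emb_F)
qed (simp_all add: frag_eval_0 frag_eval_diff frag_eval_of emb_add distrib_left distrib_right)

text \<open>Writing an element of \<open>E\<close> as \<open>u + v * \<alpha>\<close> and moving
  \<open>u\<close> and \<open>v\<close> across the tensor sign as real factors leaves only the
  generators over \<open>e\<close> and \<open>\<alpha>\<close>, so the base change has at most two
  real coordinates.\<close>

lemma N_normal_form:
  assumes "x \<in> carrier R"
  shows "\<exists>r s. x - (frag_of (e, r) + frag_of (\<alpha>, s)) \<in> N"
proof -
  have eE: "e \<in> E" by (rule F_E[OF F_one])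
  have "Poly_Mapping.keys x \<subseteq> E \<times> UNIV" using assms by (simp add: pair_ring_eq)
  then show ?thesis
  proof (induction x rule: keys_frag_induct)
    case zero
    \<comment> \<open>A generator with second entry 0 is not the zero formal sum; it is the negative
      of the relation \<open>add_right\<close> for 0 + 0.\<close>
    have z: "frag_of (a, 0) \<in> N" if "a \<in> E" for a
      using tensor_null_uminus[OF tensor_null.add_right[OF that, of 0 UNIV 0 F "(*)" "\<lambda>c r. \<sigma> c * r"]] by simp
    have "0 - (frag_of (e, 0) + frag_of (\<alpha>, 0)) \<in> N"
      by (intro tensor_null.diff tensor_null_add tensor_null.zero z eE \<alpha>_E)
    then show ?case by blast
  next
    case (of a b)
    obtain u v where a: "u \<in> F" "v \<in> F" "a = u + v * \<alpha>" using of(1) by (rule E_cases)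
    have va: "v * \<alpha> \<in> E" using E_mult F_E \<alpha>_E a by blast
    have ue: "u * e = u" using E_comm[of u e] E_one[of u] F_E F_one a by simp
    have "frag_of (a, b) - frag_of (u, b) - frag_of (v * \<alpha>, b) \<in> N"
      unfolding a(3) using va F_E a by (intro tensor_null.add_left) auto
    moreover have "frag_of (u * e, b) - frag_of (e, \<sigma> u * b) \<in> N"
      using a eE by (intro tensor_null.balanced) auto
    moreover have "frag_of (v * \<alpha>, b) - frag_of (\<alpha>, \<sigma> v * b) \<in> N"
      using a \<alpha>_E by (intro tensor_null.balanced) auto
    ultimately have "(frag_of (a, b) - frag_of (u, b) - frag_of (v * \<alpha>, b)) +
        (frag_of (u * e, b) - frag_of (e, \<sigma> u * b)) +
        (frag_of (v * \<alpha>, b) - frag_of (\<alpha>, \<sigma> v * b)) \<in> N" by (intro tensor_null_add)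
    then have "frag_of (a, b) - (frag_of (e, \<sigma> u * b) + frag_of (\<alpha>, \<sigma> v * b)) \<in> N"
      by (simp add: ue algebra_simps)
    then show ?case by blast
  next
    case (diff x y)
    then obtain r s r' s' where x: "x - (frag_of (e, r) + frag_of (\<alpha>, s)) \<in> N"
      and y: "y - (frag_of (e, r') + frag_of (\<alpha>, s')) \<in> N" by blast
    have d: "frag_of (a, r) - frag_of (a, r - r') - frag_of (a, r') \<in> N" if "a \<in> E" for a r r'
      using tensor_null.add_right[OF that, of "r - r'" UNIV r' F "(*)" "\<lambda>c r. \<sigma> c * r"] by simp
    have "(x - (frag_of (e, r) + frag_of (\<alpha>, s))) - (y - (frag_of (e, r') + frag_of (\<alpha>, s'))) +
      (frag_of (e, r) - frag_of (e, r - r') - frag_of (e, r')) +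
      (frag_of (\<alpha>, s) - frag_of (\<alpha>, s - s') - frag_of (\<alpha>, s')) \<in> N"
      by (intro tensor_null_add tensor_null.diff x y d eE \<alpha>_E)
    then have "(x - y) - (frag_of (e, r - r') + frag_of (\<alpha>, s - s')) \<in> N"
      by (simp add: algebra_simps)
    then show ?case by blast
  qed
qed

text \<open>On a normal form the evaluation is \<open>r\<close> plus a nonzero imaginary multiple of
  \<open>s\<close>, so its vanishing forces both coordinates to vanish.\<close>

lemma eval_eq_0_imp_N:
  assumes "x \<in> carrier R" "eval x = 0"
  shows "x \<in> N"
proof -
  obtain r s where rs: "x - (frag_of (e, r) + frag_of (\<alpha>, s)) \<in> N"
    using N_normal_form[OF assms(1)] by blast
  from N_eval[OF this] have "Complex r (sqrt (- \<sigma> (\<alpha> * \<alpha>)) * s) = 0"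
    using assms(2)
    by (simp add: frag_eval_diff frag_eval_add frag_eval_of emb_one emb_\<alpha> complex_eq_iff)
  then have "r = 0" "s = 0" using \<sigma>_\<alpha> by (auto simp: complex_eq_iff)
  have z: "frag_of (a, 0) \<in> N" if "a \<in> E" for a
    using tensor_null_uminus[OF tensor_null.add_right[OF that, of 0 UNIV 0 F "(*)" "\<lambda>c r. \<sigma> c * r"]] by simp
  have "x - (frag_of (e, r) + frag_of (\<alpha>, s)) + (frag_of (e, 0) + frag_of (\<alpha>, 0)) \<in> N"
    by (intro tensor_null_add z rs \<alpha>_E F_E F_one)
  then show ?thesis by (simp add: \<open>r = 0\<close> \<open>s = 0\<close>)
qed

text \<open>The first isomorphism theorem for \<open>eval\<close>. Identifying \<open>N\<close> with
  the kernel also spares a separate check that the tensor relations form an ideal.\<close>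

theorem base_change_is_complex: "base_change_is_complex F \<sigma> E e"
proof -
  let ?C = "ring_of_type_algebra :: complex ring"
  interpret R: ring R
    by (rule ring_pair_ring) (use E_mult E_one E_comm F_E[OF F_one] in auto)
  interpret C: cring ?C by rule
  have hom: "eval \<in> ring_hom R ?C"
  proof (rule ring_hom_memI)
    fix x y assume x: "x \<in> carrier R" and y: "y \<in> carrier R"
    have "Poly_Mapping.keys y \<subseteq> E \<times> UNIV" using y by (simp add: pair_ring_eq)
    then have 1: "eval (pair_mult (frag_of (a, r)) y) = eval (frag_of (a, r)) * eval y" if "a \<in> E" for a r
    proof (induction y rule: keys_frag_induct)
      case (of a' r')
      with that show ?case by (simp add: pair_mult_of frag_eval_of emb_mult mult_ac)
    qed (simp_all add: pair_mult_zero pair_mult_diff frag_eval_0 frag_eval_diff right_diff_distrib)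
    have "Poly_Mapping.keys x \<subseteq> E \<times> UNIV" using x by (simp add: pair_ring_eq)
    then have "eval (pair_mult x y) = eval x * eval y"
      by (induction x rule: keys_frag_induct)
        (simp_all add: pair_mult_zero pair_mult_diff frag_eval_0 frag_eval_diff 1 left_diff_distrib)
    then show "eval (x \<otimes>\<^bsub>R\<^esub> y) = eval x \<otimes>\<^bsub>?C\<^esub> eval y" by (simp add: pair_ring_eq ring_of_type_algebra_def)
    show "eval (x \<oplus>\<^bsub>R\<^esub> y) = eval x \<oplus>\<^bsub>?C\<^esub> eval y"
      by (simp add: pair_ring_eq ring_of_type_algebra_def frag_eval_add)
  qed (simp_all add: pair_ring_eq ring_of_type_algebra_def frag_eval_of emb_one)
  interpret h: ring_hom_ring R ?C eval
    by (rule ring_hom_ringI2) (fact R.ring_axioms C.ring_axioms hom)+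
  have "eval ` carrier R = carrier ?C"
  proof -
    have "z \<in> eval ` carrier R" for z
    proof -
      let ?q = "sqrt (- \<sigma> (\<alpha> * \<alpha>))"
      \<comment> \<open>The imaginary part is divided by the factor that \<open>emb \<alpha>\<close>
        introduces. The two minus signs cancel; a difference is used because
        \<open>keys_diff_subset\<close> then gives membership in the carrier.\<close>
      let ?x = "frag_of (e, Re z) - frag_of (\<alpha>, - (Im z / ?q))"
      have "eval ?x = z"
        using \<sigma>_\<alpha> by (simp add: frag_eval_diff frag_eval_of emb_one emb_\<alpha> complex_eq_iff)
      moreover have "?x \<in> carrier R"
        by (simp add: pair_ring_eq keys_diff_subset \<alpha>_E F_E F_one)
      ultimately show ?thesis by (intro image_eqI[where x = ?x]) simp_all
    qed
    then show ?thesis by (auto simp: ring_of_type_algebra_def)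
  qed
  from h.FactRing_iso_set[OF this]
  have iso: "(\<lambda>Y. the_elem (eval ` Y)) \<in> ring_iso (R Quot a_kernel R ?C eval) ?C" .
  have ker: "a_kernel R ?C eval = N"
    unfolding a_kernel_def' using N_carrier N_eval eval_eq_0_imp_N
    by (auto simp: ring_of_type_algebra_def)
  have "the_elem (eval ` real_base_change_scalar F \<sigma> E e r) = of_real r" for r
  proof -
    have "eval ` real_base_change_scalar F \<sigma> E e r = {of_real r}"
    proof -
      have ev: "eval y = of_real r" if "y \<in> real_base_change_scalar F \<sigma> E e r" for y
        using that unfolding real_base_change_scalar_def a_r_coset_def'
        by (auto simp: pair_ring_eq frag_eval_add frag_eval_of emb_one N_eval)
      have mem: "frag_of (e, r) \<in> real_base_change_scalar F \<sigma> E e r"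
        unfolding real_base_change_scalar_def a_r_coset_def'
        using tensor_null.zero by (force simp: pair_ring_eq)
      show ?thesis by (auto simp: ev intro!: rev_image_eqI[OF mem])
    qed
    then show ?thesis by simp
  qed
  with iso show ?thesis
    unfolding base_change_is_complex_def real_base_change_def tensor_algebra_def ker
    by (intro bexI[of _ "\<lambda>Y. the_elem (eval ` Y)"]) simp_all
qed

end

section \<open>The center\<close>

lemma center_ring_on: "center_ring = ring_on {a :: 'h::rat_algebra. \<forall>x. a * x = x * a}"
  by (simp add: center_ring_def ring_on_def)

lemma center_invariants_ring_on:
  "center_invariants t = ring_on {a \<in> {a :: 'h::rat_algebra. \<forall>x. a * x = x * a}. t a = a}"
  by (simp add: center_invariants_def center_ring_def ring_on_def)

text \<open>\<open>t\<close> reverses products in general, and commutativity of the center turns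
  this into multiplicativity there.\<close>

lemma (in hodge_algebra_2) center_positive_involutive:
  "positive_involutive_algebra {a. \<forall>x. a * x = x * a} (\<lambda>x y. - form x y) t"
proof
  show "rat_vector.subspace {a::'h. \<forall>x. a * x = x * a}"
    by (rule rat_vector.subspaceI) (simp_all add: distrib_left distrib_right mult_scaleQ_left mult_scaleQ_right)
  show "x * y \<in> {a. \<forall>x. a * x = x * a}" if "x \<in> {a. \<forall>x. a * x = x * a}" "y \<in> {a. \<forall>x. a * x = x * a}"
    for x y :: 'h
  proof -
    have x: "x * z = z * x" and y: "y * z = z * y" for z using that by blast+
    have "x * y * z = z * (x * y)" for z
      unfolding mult.assoc[of x y z] y[of z] by (simp add: x[of z] flip: mult.assoc)
    then show ?thesis by blast
  qed
  show "0 < - form x x" if "x \<in> {a. \<forall>x. a * x = x * a}" "x \<noteq> 0" for x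
    using form_negative_central[of x] that by simp
  show "t x \<in> {a. \<forall>x. a * x = x * a}" if "x \<in> {a. \<forall>x. a * x = x * a}" for x
    using t_central[of x] that by blast
  show "x * y = y * x" if "x \<in> {a. \<forall>x. a * x = x * a}" for x y
    using that by blast
  show "t (x * y) = t x * t y" if "x \<in> {a. \<forall>x. a * x = x * a}" for x y
  proof -
    have "x * y = y * x" using that by blast
    then show ?thesis by (simp add: t_mult)
  qed
  show "- form x y = - form y x" for x y using form_sym by simp
  show "- form (a * x) y = - form x (t a * y)" for a x y by (simp add: adjoint_left)
  show "- form (x + x') y = - form x y + - form x' y" for x x' y by (simp add: form_add)
  show "- form (q *\<^sub>Q x) y = q * - form x y" for q x y by (simp add: form_scale)
  show "1 \<in> {a::'h. \<forall>x. a * x = x * a}" by simp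
qed (fact finite_dimensional t_add t_scale t_t)+

context positive_involutive_algebra
begin

lemma base_change_corner_is_complex:
  assumes field: "field (factor_ring (ring_on Ainv) e)" and e: "e \<in> Ainv"
    and ne: "inv.corner e \<noteq> corner e"
    and \<sigma>: "\<sigma> \<in> ring_hom (factor_ring (ring_on Ainv) e) (ring_of_type_algebra :: real ring)"
  shows "base_change_is_complex (inv.corner e) \<sigma> (corner e) e"
proof -
  note idem = inv.field_corner_idem[OF field e]
  obtain \<alpha> where \<alpha>: "\<alpha> \<in> A" "e * \<alpha> = \<alpha>" "t \<alpha> = - \<alpha>" "\<alpha> \<noteq> 0"
    using exists_skew[OF e idem(1) ne] by blast
  note decomposition = corner_skew_decomposition[OF field e \<alpha>]
  note cI = inv.corner_iff[OF e idem(1)] and hom = inv.corner_homD[OF field \<sigma>]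
  have cA: "x \<in> corner e \<longleftrightarrow> x \<in> A \<and> e * x = x" for x using corner_iff[of e x] e idem by simp
  note sub = inv.subspace_corner[of e]
  have "imaginary_quadratic_extension (inv.corner e) (corner e) e \<alpha> \<sigma>"
  proof
    show "0 \<in> inv.corner e" by (rule rat_vector.subspace_0[OF sub])
    show "x + y \<in> inv.corner e" if "x \<in> inv.corner e" "y \<in> inv.corner e" for x y
      by (rule rat_vector.subspace_add[OF sub that])
    show "x * y \<in> inv.corner e" if "x \<in> inv.corner e" "y \<in> inv.corner e" for x y
      using that unfolding cI by (simp add: mult_mem t_mult flip: mult.assoc)
    show "u = u' \<and> v = v'" if "u \<in> inv.corner e" "v \<in> inv.corner e" "u' \<in> inv.corner e" "v' \<in> inv.corner e"
      "u + v * \<alpha> = u' + v' * \<alpha>" for u v u' v'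
    proof -
      have "u - u' \<in> inv.corner e" "v - v' \<in> inv.corner e"
        using that rat_vector.subspace_diff[OF sub] by blast+
      moreover have "(u - u') + (v - v') * \<alpha> = 0" using that(5) by (simp add: left_diff_distrib algebra_simps)
      ultimately show ?thesis using decomposition(2)[of "u - u'" "v - v'"] by simp
    qed
    show "\<alpha> * \<alpha> \<in> inv.corner e"
      using \<alpha> unfolding cI by (simp add: mult_mem t_mult flip: mult.assoc)
    show "\<sigma> (\<alpha> * \<alpha>) < 0" by (rule hom_skew_square_neg[OF field e \<sigma> \<alpha>])
    show "x * y = y * x" if "x \<in> corner e" "y \<in> corner e" for x y
      using that mult_comm unfolding cA by blast
    show "e * x = x" if "x \<in> corner e" for x
      using that unfolding cA by blast
  qed (fact idem(2) decomposition(1) \<alpha>(2) hom(1-3))+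
  then show ?thesis by (rule imaginary_quadratic_extension.base_change_is_complex)
qed

end

theorem lemma4:
  fixes Hdg :: "int \<Rightarrow> int \<Rightarrow> 'h::rat_algebra complexification set"
    and form :: "'h \<Rightarrow> 'h \<Rightarrow> rat"
    and t :: "'h \<Rightarrow> 'h"
    and K Kp :: "'h ring"
  assumes "hodge_algebra_2 Hdg form t"
    and K_def: "K = center_ring"
    and Kp_def: "Kp = center_invariants t"
  shows "(\<exists>es. ring_product_by K es \<and> (\<forall>e\<in>set es. number_field (factor_ring K e)))
    \<and> (\<exists>es. ring_product_by Kp es \<and>
          (\<forall>e\<in>set es. number_field (factor_ring Kp e) \<and> totally_real (factor_ring Kp e)))
    \<and> (\<forall>es. ring_product_by Kp es \<longrightarrow> (\<forall>e\<in>set es. number_field (factor_ring Kp e)) \<longrightarrow>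
          (\<forall>e\<in>set es. carrier (factor_ring Kp e) \<noteq> carrier (factor_ring K e) \<longrightarrow>
             field (factor_ring K e) \<and>
             (\<forall>\<sigma> \<in> ring_hom (factor_ring Kp e) (ring_of_type_algebra :: real ring).
                base_change_is_complex (carrier (factor_ring Kp e)) \<sigma>
                  (carrier (factor_ring K e)) e)))"
proof -
  interpret hodge_algebra_2 Hdg form t by fact
  let ?A = "{a :: 'h. \<forall>x. a * x = x * a}"
  interpret Z: positive_involutive_algebra ?A "\<lambda>x y. - form x y" t
    by (rule center_positive_involutive)
  have K: "K = ring_on ?A" by (simp add: K_def center_ring_on)
  have Kp: "Kp = ring_on Z.Ainv" unfolding Kp_def by (rule center_invariants_ring_on)
  \<comment> \<open>For an arbitrary decomposition only membership is extracted; the remaining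
    properties of \<open>e\<close> follow from its factor being a field.\<close>
  have mem: "e \<in> Z.Ainv" if "ring_product_by Kp es" "e \<in> set es" for e es
    using that by (auto simp: ring_product_by_def Kp ring_on_def)
  have carriers: "carrier (factor_ring Kp e) = Z.inv.corner e" "carrier (factor_ring K e) = Z.corner e" for e
    by (simp_all add: K Kp factor_ring_on)
  have "\<exists>es. ring_product_by K es \<and> (\<forall>e\<in>set es. number_field (factor_ring K e))"
    unfolding K by (rule Z.product_of_number_fields)
  moreover have "\<exists>es. ring_product_by Kp es \<and>
      (\<forall>e\<in>set es. number_field (factor_ring Kp e) \<and> totally_real (factor_ring Kp e))"
  proof -
    obtain es where es: "ring_product_by Kp es" "\<And>e. e \<in> set es \<Longrightarrow> number_field (factor_ring Kp e)"
      using Z.inv.product_of_number_fields unfolding Kp by blast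
    have "totally_real (factor_ring Kp e)" if "e \<in> set es" for e
      using Z.totally_real_corner[OF _ mem[OF es(1) that]] es(2)[OF that] unfolding Kp number_field_def by blast
    then show ?thesis using es by blast
  qed
  moreover have "field (factor_ring K e) \<and>
      (\<forall>\<sigma> \<in> ring_hom (factor_ring Kp e) (ring_of_type_algebra :: real ring).
        base_change_is_complex (carrier (factor_ring Kp e)) \<sigma> (carrier (factor_ring K e)) e)"
    if "ring_product_by Kp es" "\<forall>e\<in>set es. number_field (factor_ring Kp e)" "e \<in> set es"
      "carrier (factor_ring Kp e) \<noteq> carrier (factor_ring K e)" for es e
  proof -
    have e: "e \<in> Z.Ainv" by (rule mem[OF that(1,3)])
    have field: "field (factor_ring (ring_on Z.Ainv) e)" using that(2,3) unfolding Kp number_field_def by blast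
    have ne: "Z.inv.corner e \<noteq> Z.corner e" using that(4) unfolding carriers .
    have "field (factor_ring K e)" unfolding K by (rule Z.field_corner_of_inv[OF field e])
    moreover have "base_change_is_complex (carrier (factor_ring Kp e)) \<sigma> (carrier (factor_ring K e)) e"
      if "\<sigma> \<in> ring_hom (factor_ring Kp e) (ring_of_type_algebra :: real ring)" for \<sigma>
      unfolding carriers using that unfolding Kp by (rule Z.base_change_corner_is_complex[OF field e ne])
    ultimately show ?thesis by simp
  qed
  ultimately show ?thesis by blast
qed

end
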